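(* Let $n\ge 2$, let $\vec{\pi}\in(0,1)^n$, and let the step-sizes $\{\eta_t\}_{t\ge 0}$ be positive, non-increasing, with $\sum_{t=0}^\infty \eta_t=\infty$ and $\sum_{t=0}^\infty \eta_t^2<\infty$. Let $\{\vec{P}_{\mathrm{pr}}(t)\}_{t\ge 0}$ be the online estimator with resettings described in the context. Then, with probability one, $\{\vec{P}_{\mathrm{pr}}(t)\}$ converges to the set $\bar{\mathcal{E}}=\mathcal{E}\cup\mathcal{E}_{\mathrm{boundary}}$, i.e. $\lim_{t\to\infty} d(\vec{P}_{\mathrm{pr}}(t),\bar{\mathcal{E}})=0$ almost surely, where $\mathcal{E}=\{\vec{x}\in(0,1)^n \mid \vec{f}(\vec{x})=\vec{0}\}$ and $\mathcal{E}_{\mathrm{boundary}}$ is the collection of $2n$ points $$\mathcal{E}_{\mathrm{boundary}}=\bigcup_{i=1}^n\{\vec{x}\in\mathcal{X}_{\mathrm{bound}} \mid x_i\in\{0,1\},\ x_j=(1-x_i)\,h(\pi_i,1-\pi_j)+x_i\,h(\pi_i,\pi_j)\ \ \forall j\in[n]\setminus\{i\}\}.$$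
   Context: Notation: $[n]=\{1,\dots,n\}$; $h(a,b)=ab+(1-a)(1-b)$ for $a,b\in[0,1]$; $d(\vec{x},A)=\inf_{\vec{y}\in A}\|\vec{x}-\vec{y}\|$; $\mathbb{1}_{\{\cdot\}}$ is the indicator. Model: $\{S(t)\}_{t\ge1}$ are i.i.d. uniform on $\{+1,-1\}$. Given $S(t)$, the outputs $R_1(t),\dots,R_n(t)$ are independent with $\Pr(R_i(t)=-s\mid S(t)=s)=\pi_i$ and $\Pr(R_i(t)=s\mid S(t)=s)=1-\pi_i$ for $s\in\{\pm1\}$ (memoryless binary symmetric channels). Hence the vectors $\vec{R}(t)\in\{\pm1\}^n$, $t\ge1$, are i.i.d. with law $g_{\vec{\pi}}$, where $$g_{\vec{x}}(\vec{r})=\tfrac12\Big(\prod_{i=1}^n x_i^{\frac{1+r_i}{2}}(1-x_i)^{\frac{1-r_i}{2}}+\prod_{i=1}^n x_i^{\frac{1-r_i}{2}}(1-x_i)^{\frac{1+r_i}{2}}\Big).$$ Domain: $\mathcal{X}=(0,1)^n$. For $i\in[n]$, $\mathcal{X}^{(i)}_{\mathrm{bound}}=\{\vec{x}\in[0,1]^n\mid x_i\in\{0,1\},\ x_j\in(0,1)\ \forall j\ne i\}$; $\mathcal{X}_{\mathrm{bound}}=\bigcup_{i}\mathcal{X}^{(i)}_{\mathrm{bound}}$ and $\bar{\mathcal{X}}=\mathcal{X}\cup\mathcal{X}_{\mathrm{bound}}$. Vector fields: for $\vec{x}\in\mathcal{X}$, $\vec{r}\in\{\pm1\}^n$, $L(\vec{r},\vec{x})=\prod_{i=1}^n\big(\frac{x_i}{1-x_i}\big)^{r_i}$,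 and $\tilde f_i(\vec{r},\vec{x})=\frac12\Big(1+\frac{L(\vec{r},\vec{x})-1}{L(\vec{r},\vec{x})+1}r_i\Big)-x_i$. For $\vec{x}\in\mathcal{X}^{(i)}_{\mathrm{bound}}$ the ratio $\frac{L(\vec{r},\vec{x})-1}{L(\vec{r},\vec{x})+1}$ is defined to be $-1$ if $(-1)^{x_i}=r_i$ and $+1$ if $(-1)^{x_i}\ne r_i$, and $\tilde f$ is then defined by the same formula. The mean field is $\vec{f}(\vec{x})=\mathbb{E}_{\vec{R}\sim g_{\vec{\pi}}}[\tilde{\vec{f}}(\vec{R},\vec{x})]$, $\vec{x}\in\bar{\mathcal{X}}$. Estimator with resettings: $\{\mathcal{K}_t\}_{t\ge0}$ is a sequence of compact sets with $\mathcal{K}_t\subseteq\mathcal{K}_{t+1}$ and $\bigcup_{t}\mathcal{K}_t=\bar{\mathcal{X}}$. Fix $\vec{P}_0\in\mathcal{K}_0$ and an initial estimate $\vec{P}_{\mathrm{pr}}(0)\in\mathcal{K}_0$, and set $\gamma(0)=0$. For $t\ge0$ let $\vec{y}=\vec{P}_{\mathrm{pr}}(t)+\eta_t\tilde{\vec{f}}(\vec{R}(t+1),\vec{P}_{\mathrm{pr}}(t))$. Then $\vec{P}_{\mathrm{pr}}(t+1)=\vec{y}$ if $\vec{y}\in\mathcal{K}_{\gamma(t)}$ and $\vec{P}_{\mathrm{pr}}(t+1)=\vec{P}_0$ otherwise, and $\gamma(t+1)=\gamma(t)+\mathbb{1}_{\{\vec{y}\notin\mathcal{K}_{\gamma(t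)}\}}$.
   Formalization: The formal theorem additionally assumes that every compact subset of X̄ is contained in some K_t (as when K_t lies in the relative interior of K_{t+1}); with only increasing compact sets of union X̄, the estimator can be reset at every step and the claim fails. *)

theory Defs
  imports "HOL-Probability.Probability"
begin

text \<open>
  The dimension n is \<open>CARD('n)\<close>.  Sign vectors have type \<open>int ^ 'n\<close> with entries in \<open>{-1, 1}\<close>,
  so that signs can be used as exponents (\<open>powi\<close>, \<open>nat\<close>).
\<close>

definition sign_vectors :: "(int ^ 'n::finite) set" where
  "sign_vectors = {r. \<forall>i. r $ i \<in> {-1, 1}}"

definition h_bsc :: "real \<Rightarrow> real \<Rightarrow> real" where
  "h_bsc a b = a * b + (1 - a) * (1 - b)"

definition g_law :: "real ^ 'n::finite \<Rightarrow> int ^ 'n \<Rightarrow> real" where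
  "g_law x r = 1/2 *
     ((\<Prod>i\<in>UNIV. (x $ i) ^ nat ((1 + r $ i) div 2) * (1 - x $ i) ^ nat ((1 - r $ i) div 2)) +
      (\<Prod>i\<in>UNIV. (x $ i) ^ nat ((1 - r $ i) div 2) * (1 - x $ i) ^ nat ((1 + r $ i) div 2)))"

text \<open>
  Memoryless binary symmetric channels driven by uniform random signs, at times \<open>t \<ge> 1\<close>.
  Independence over time is that of the pairs (input, output vector).
\<close>

locale bsc_model = prob_space M for M :: "'a measure" +
  fixes \<pi> :: "real ^ 'n::finite"
    and S :: "nat \<Rightarrow> 'a \<Rightarrow> int"
    and R :: "nat \<Rightarrow> 'a \<Rightarrow> int ^ 'n"
  assumes indep_over_time:
      "indep_vars (\<lambda>_. count_space UNIV) (\<lambda>t \<omega>. (S t \<omega>, R t \<omega>)) {1..}"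
    and input_uniform:
      "\<And>t s. t \<ge> 1 \<Longrightarrow> s \<in> {-1, 1} \<Longrightarrow> \<P>(\<omega> in M. S t \<omega> = s) = 1/2"
    and outputs_cond_indep:
      "\<And>t s r. t \<ge> 1 \<Longrightarrow> s \<in> {-1, 1} \<Longrightarrow> r \<in> sign_vectors \<Longrightarrow>
         \<P>(\<omega> in M. R t \<omega> = r \<bar> S t \<omega> = s) = (\<Prod>i\<in>UNIV. \<P>(\<omega> in M. R t \<omega> $ i = r $ i \<bar> S t \<omega> = s))"
    and channel_flip:
      "\<And>t s i. t \<ge> 1 \<Longrightarrow> s \<in> {-1, 1} \<Longrightarrow> \<P>(\<omega> in M. R t \<omega> $ i = - s \<bar> S t \<omega> = s) = \<pi> $ i"
    and channel_keep:
      "\<And>t s i. t \<ge> 1 \<Longrightarrow> s \<in> {-1, 1} \<Longrightarrow> \<P>(\<omega> in M. R t \<omega> $ i = s \<bar> S t \<omega> = s) = 1 - \<pi> $ i"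

definition X_dom :: "(real ^ 'n::finite) set" where
  "X_dom = {x. \<forall>i. 0 < x $ i \<and> x $ i < 1}"

definition X_bound_at :: "'n::finite \<Rightarrow> (real ^ 'n) set" where
  "X_bound_at i = {x. x $ i \<in> {0, 1} \<and> (\<forall>j. j \<noteq> i \<longrightarrow> 0 < x $ j \<and> x $ j < 1)}"

definition X_bound :: "(real ^ 'n::finite) set" where
  "X_bound = (\<Union>i. X_bound_at i)"

definition X_bar :: "(real ^ 'n::finite) set" where
  "X_bar = X_dom \<union> X_bound"

definition lik_ratio :: "int ^ 'n::finite \<Rightarrow> real ^ 'n \<Rightarrow> real" where
  "lik_ratio r x = (\<Prod>i\<in>UNIV. (x $ i / (1 - x $ i)) powi (r $ i))"

text \<open>
  The ratio \<open>(L - 1) / (L + 1)\<close> for the likelihood ratio \<open>L\<close>, with its boundary values.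
  For \<open>x \<in> X_bound\<close> the index \<open>i\<close> with \<open>x \<in> X_bound_at i\<close> is unique.  Values outside
  \<open>X_bar\<close> are meaningless and never used: the estimator below stays in \<open>X_bar\<close>.
\<close>

definition L_ratio :: "int ^ 'n::finite \<Rightarrow> real ^ 'n \<Rightarrow> real" where
  "L_ratio r x =
     (if x \<in> X_dom then (lik_ratio r x - 1) / (lik_ratio r x + 1)
      else let i = (THE i. x \<in> X_bound_at i)
           in if (-1) ^ nat \<lfloor>x $ i\<rfloor> = r $ i then -1 else 1)"

definition f_tilde :: "int ^ 'n::finite \<Rightarrow> real ^ 'n \<Rightarrow> real ^ 'n" where
  "f_tilde r x = (\<chi> i. 1/2 * (1 + L_ratio r x * of_int (r $ i)) - x $ i)"

definition mean_field :: "real ^ 'n::finite \<Rightarrow> real ^ 'n \<Rightarrow> real ^ 'n" where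
  "mean_field \<pi> x = (\<Sum>r\<in>sign_vectors. g_law \<pi> r *\<^sub>R f_tilde r x)"

definition E_int :: "real ^ 'n::finite \<Rightarrow> (real ^ 'n) set" where
  "E_int \<pi> = {x \<in> X_dom. mean_field \<pi> x = 0}"

definition E_boundary :: "real ^ 'n::finite \<Rightarrow> (real ^ 'n) set" where
  "E_boundary \<pi> = (\<Union>i. {x \<in> X_bound. x $ i \<in> {0, 1} \<and>
     (\<forall>j. j \<noteq> i \<longrightarrow>
        x $ j = (1 - x $ i) * h_bsc (\<pi> $ i) (1 - \<pi> $ j) + x $ i * h_bsc (\<pi> $ i) (\<pi> $ j))})"

definition E_bar :: "real ^ 'n::finite \<Rightarrow> (real ^ 'n) set" where
  "E_bar \<pi> = E_int \<pi> \<union> E_boundary \<pi>"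

definition truncation_sets :: "(nat \<Rightarrow> (real ^ 'n::finite) set) \<Rightarrow> bool" where
  "truncation_sets K \<longleftrightarrow>
     (\<forall>t. compact (K t)) \<and> (\<forall>t. K t \<subseteq> K (Suc t)) \<and> (\<Union>t. K t) = X_bar"

text \<open>
  As usual for randomly varying truncations, the sets \<open>K t\<close> must exhaust \<open>X_bar\<close> also in the
  sense that each compact subset of \<open>X_bar\<close> lies in some \<open>K t\<close>.  This holds for instance if
  each \<open>K t\<close> is contained in the interior of \<open>K (Suc t)\<close> relative to \<open>X_bar\<close>.

  It does not follow from \<open>truncation_sets K\<close>, and convergence fails without it.  Let
  \<open>P\<^sub>0 \<in> X_dom\<close> be a point with \<open>mean_field \<pi> P\<^sub>0 \<noteq> 0\<close> and \<open>f_tilde r P\<^sub>0 \<noteq> 0\<close>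
  for all sign vectors \<open>r\<close>, and start at \<open>P\<^sub>0\<close>.  Given sets satisfying \<open>truncation_sets\<close>, the
  first of which contains \<open>P\<^sub>0\<close>, remove from the t-th one, for all \<open>s \<ge> t\<close> and all \<open>r\<close>, an open
  ball about \<open>P\<^sub>0 + \<eta> s *\<^sub>R f_tilde r P\<^sub>0\<close> of radius \<open>\<eta> s / 2 * norm (f_tilde r P\<^sub>0)\<close>.
  These balls miss \<open>P\<^sub>0\<close> and shrink to it, so the new sets again satisfy
  \<open>truncation_sets\<close>; but every step is a reset, and the estimator stays at \<open>P\<^sub>0\<close>.
\<close>

definition exhausts_compacts :: "(nat \<Rightarrow> (real ^ 'n::finite) set) \<Rightarrow> bool" where
  "exhausts_compacts K \<longleftrightarrow> (\<forall>C. compact C \<and> C \<subseteq> X_bar \<longrightarrow> (\<exists>t. C \<subseteq> K t))"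

text \<open>
  The pair (estimate, number of resettings so far), as a function of an observation sequence
  \<open>r\<close> of which only the entries at times \<open>t \<ge> 1\<close> are used.
\<close>

primrec estimator ::
  "(nat \<Rightarrow> (real ^ 'n::finite) set) \<Rightarrow> (nat \<Rightarrow> real) \<Rightarrow> real ^ 'n \<Rightarrow> real ^ 'n \<Rightarrow>
     (nat \<Rightarrow> int ^ 'n) \<Rightarrow> nat \<Rightarrow> (real ^ 'n) \<times> nat" where
  "estimator K \<eta> P\<^sub>0 P_init r 0 = (P_init, 0)"
| "estimator K \<eta> P\<^sub>0 P_init r (Suc t) =
     (let (p, \<gamma>) = estimator K \<eta> P\<^sub>0 P_init r t;
          y = p + \<eta> t *\<^sub>R f_tilde (r (Suc t)) p
      in if y \<in> K \<gamma> then (y, \<gamma>) else (P\<^sub>0, \<gamma> + 1))"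

definition P_pr ::
  "(nat \<Rightarrow> (real ^ 'n::finite) set) \<Rightarrow> (nat \<Rightarrow> real) \<Rightarrow> real ^ 'n \<Rightarrow> real ^ 'n \<Rightarrow>
     (nat \<Rightarrow> int ^ 'n) \<Rightarrow> nat \<Rightarrow> real ^ 'n" where
  "P_pr K \<eta> P\<^sub>0 P_init r t = fst (estimator K \<eta> P\<^sub>0 P_init r t)"

end

theory Submission
  imports Defs
begin


text \<open>
  The potential is the expected log-likelihood \<open>\<ell>(x) = E ln g_x(R)\<close> under the true law of \<open>R\<close>.  On the
  whole of \<open>X_bar\<close> the update satisfies \<open>f_tilde_i = x_i (1 - x_i) \<partial>_i ln g_x(r)\<close>, so the mean field is
  the gradient of \<open>\<ell>\<close> rescaled by \<open>x_i (1 - x_i)\<close>, and a step increases \<open>\<ell>\<close> by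
  \<open>\<eta> \<Sum> x_i (1 - x_i) (\<partial>_i \<ell>)\<^sup>2\<close> up to a martingale difference and an error of order \<open>\<eta>\<^sup>2\<close>, uniformly on each
  compact set where all \<open>g_x(r)\<close> exceed a positive constant.  The drift vanishes exactly at the zeros of the mean
  field, and on the boundary of the cube these are the points of \<open>E_boundary\<close>.

  The martingale differences are square summable, so the noise sums converge almost surely.  Superlevel sets of
  \<open>\<ell>\<close> are compact in \<open>X_bar\<close>, so after a late reset the run never leaves such a set, and there are only
  finitely many resets.  From then on the drift is summable against \<open>\<eta>\<close>; as the estimate moves by
  \<open>O(\<eta>)\<close> per step and \<open>\<eta>\<close> is not summable, the drift tends to 0.
\<close>

section \<open>Channel law and sums over sign vectors\<close>

text \<open>
  \<open>wt r x\<close> is the probability of the outputs \<open>r\<close> given the input -1; given the input 1 it is \<open>wt (- r) x\<close>.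
  Hence \<open>mix\<close> is \<open>g_law\<close> on sign vectors, and \<open>score i\<close> is the i-th partial derivative of \<open>ln (mix r x)\<close>.
\<close>

definition chan :: "int \<Rightarrow> real \<Rightarrow> real" where
  "chan s a = (if s = 1 then a else 1 - a)"

definition wt :: "int ^ 'n::finite \<Rightarrow> real ^ 'n \<Rightarrow> real" where
  "wt r x = (\<Prod>i\<in>UNIV. chan (r $ i) (x $ i))"

definition wtx :: "'n \<Rightarrow> int ^ 'n::finite \<Rightarrow> real ^ 'n \<Rightarrow> real" where
  "wtx i r x = (\<Prod>j\<in>UNIV - {i}. chan (r $ j) (x $ j))"

definition mix :: "int ^ 'n::finite \<Rightarrow> real ^ 'n \<Rightarrow> real" where
  "mix r x = (wt r x + wt (- r) x) / 2"

definition cube :: "(real ^ 'n::finite) set" where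
  "cube = {x. \<forall>i. 0 \<le> x $ i \<and> x $ i \<le> 1}"

definition score :: "'n \<Rightarrow> int ^ 'n::finite \<Rightarrow> real ^ 'n \<Rightarrow> real" where
  "score i r x = of_int (r $ i) * (wtx i r x - wtx i (- r) x) / (2 * mix r x)"

text \<open>In the cube all \<open>mix r x\<close> are positive exactly on \<open>X_bar\<close>: two
  coordinates in {0, 1} make some output impossible. So these sets form a compact exhaustion of
  \<open>X_bar\<close>, on which scores are uniformly bounded.\<close>

definition level_set :: "real \<Rightarrow> (real ^ 'n::finite) set" where
  "level_set \<delta> = {x \<in> cube. \<forall>r\<in>sign_vectors. \<delta> \<le> mix r x}"

lemma sign_vectors_cases: "r \<in> sign_vectors \<Longrightarrow> r $ i = 1 \<or> r $ i = -1"
  by (auto simp: sign_vectors_def)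

lemma uminus_sign_vectors [simp]: "- r \<in> sign_vectors \<longleftrightarrow> r \<in> sign_vectors"
proof -
  have "- a \<in> {-1, 1} \<longleftrightarrow> a \<in> {-1, 1}" for a :: int by simp presburger
  then show ?thesis by (simp add: sign_vectors_def del: insert_iff)
qed

lemma bij_betw_vec_nth_sign_vectors:
  "bij_betw vec_nth (sign_vectors :: (int ^ 'n::finite) set) (PiE UNIV (\<lambda>_. {1, -1}))"
  by (rule bij_betwI[where g = vec_lambda])
     (auto simp: sign_vectors_def PiE_UNIV_domain)

lemma finite_sign_vectors [simp]: "finite (sign_vectors :: (int ^ 'n::finite) set)"
  using bij_betw_finite[OF bij_betw_vec_nth_sign_vectors] by (simp add: finite_PiE)

text \<open>Distributivity; expectations under a product law factor over the coordinates.\<close>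

lemma sum_sign_vectors_prod:
  fixes F :: "'n::finite \<Rightarrow> int \<Rightarrow> real"
  shows "(\<Sum>r\<in>sign_vectors. \<Prod>k\<in>UNIV. F k (r $ k)) = (\<Prod>k\<in>UNIV. F k 1 + F k (- 1))"
proof -
  have "(\<Prod>k\<in>UNIV. F k 1 + F k (- 1)) = (\<Prod>k\<in>UNIV. \<Sum>s\<in>{1, -1}. F k s)"
    by simp
  also have "\<dots> = (\<Sum>g\<in>PiE UNIV (\<lambda>_. {1, -1}). \<Prod>k\<in>UNIV. F k (g k))"
    by (rule prod_sum_PiE) auto
  also have "\<dots> = (\<Sum>r\<in>sign_vectors. \<Prod>k\<in>UNIV. F k (r $ k))"
    by (rule sum.reindex_bij_betw[OF bij_betw_vec_nth_sign_vectors, symmetric])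
  finally show ?thesis ..
qed

lemma sum_sign_vectors_uminus:
  "(\<Sum>r\<in>sign_vectors. F (- r)) = (\<Sum>r\<in>sign_vectors. F (r :: int ^ 'n::finite) :: real)"
  by (rule sum.reindex_bij_betw) (rule bij_betwI[where g = uminus], auto)

lemma g_law_eq_mix:
  assumes "r \<in> sign_vectors"
  shows "g_law x r = mix r x"
proof -
  have 1: "(x $ i) ^ nat ((1 + r $ i) div 2) * (1 - x $ i) ^ nat ((1 - r $ i) div 2) = chan (r $ i) (x $ i)"
    and 2: "(x $ i) ^ nat ((1 - r $ i) div 2) * (1 - x $ i) ^ nat ((1 + r $ i) div 2) = chan ((- r) $ i) (x $ i)" for i
    using sign_vectors_cases[OF assms, of i] by (auto simp: chan_def)
  show ?thesis
    unfolding g_law_def mix_def wt_def 1 2 by simp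
qed

lemma sum_wt: "(\<Sum>r\<in>sign_vectors. wt r x) = 1"
  using sum_sign_vectors_prod[of "\<lambda>k s. chan s (x $ k)"] by (simp add: wt_def chan_def)

text \<open>Under \<open>wt\<close> the entries are independent, and the k-th has mean
  \<open>2 * x $ k - 1\<close>.\<close>

lemma sum_wt_correlation:
  assumes "i \<noteq> j"
  shows "(\<Sum>r\<in>sign_vectors. wt r x * of_int (r $ i * r $ j)) = (2 * x $ i - 1) * (2 * x $ j - 1)"
proof -
  \<comment> \<open>The factor that coordinate \<open>k\<close> contributes to
    \<open>r $ i * r $ j\<close>, so that the integrand becomes a product over coordinates.\<close>
  define u :: "'a \<Rightarrow> int \<Rightarrow> real" where "u k s = (if k = i \<or> k = j then of_int s else 1)" for k s
  have u: "(\<Prod>k\<in>UNIV. u k (r $ k)) = of_int (r $ i * r $ j)" for r :: "int ^ 'a"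
  proof -
    have "(\<Prod>k\<in>UNIV. u k (r $ k)) = (\<Prod>k\<in>{i, j}. u k (r $ k))"
      by (rule prod.mono_neutral_right) (auto simp: u_def)
    then show ?thesis using assms by (simp add: u_def)
  qed
  have "(\<Sum>r\<in>sign_vectors. wt r x * of_int (r $ i * r $ j))
      = (\<Sum>r\<in>sign_vectors. \<Prod>k\<in>UNIV. chan (r $ k) (x $ k) * u k (r $ k))"
    unfolding wt_def prod.distrib u ..
  also have "\<dots> = (\<Prod>k\<in>UNIV. chan 1 (x $ k) * u k 1 + chan (- 1) (x $ k) * u k (- 1))"
    by (rule sum_sign_vectors_prod)
  also have "\<dots> = (\<Prod>k\<in>{i, j}. chan 1 (x $ k) * u k 1 + chan (- 1) (x $ k) * u k (- 1))"
    by (rule prod.mono_neutral_right) (auto simp: u_def chan_def)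
  also have "\<dots> = (2 * x $ i - 1) * (2 * x $ j - 1)"
    using assms by (simp add: u_def chan_def)
  finally show ?thesis .
qed

lemma sum_mix: "(\<Sum>r\<in>sign_vectors. mix r x) = 1"
  using sum_sign_vectors_uminus[of "\<lambda>r. wt r x"] sum_wt[of x]
  by (simp add: mix_def sum.distrib sum_divide_distrib[symmetric])

text \<open>The product \<open>r $ i * r $ j\<close> is unchanged when all signs flip, so both
  inputs contribute the same correlation.\<close>

lemma sum_mix_correlation:
  assumes "i \<noteq> j"
  shows "(\<Sum>r\<in>sign_vectors. mix r x * of_int (r $ i * r $ j)) = (2 * x $ i - 1) * (2 * x $ j - 1)"
proof -
  have "(\<Sum>r\<in>sign_vectors. mix r x * of_int (r $ i * r $ j))
      = ((\<Sum>r\<in>sign_vectors. wt r x * of_int (r $ i * r $ j))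
         + (\<Sum>r\<in>sign_vectors. wt (- r) x * of_int ((- r) $ i * (- r) $ j))) / 2"
    by (simp add: mix_def sum.distrib[symmetric] sum_divide_distrib algebra_simps add_divide_distrib)
  then show ?thesis
    using sum_sign_vectors_uminus[of "\<lambda>r. wt r x * of_int (r $ i * r $ j)"] sum_wt_correlation[OF assms, of x]
    by simp
qed

section \<open>Positivity, and the update written through the score\<close>

lemma chan_bounds:
  assumes "x \<in> cube" shows "0 \<le> chan s (x $ i)" "chan s (x $ i) \<le> 1"
  using assms by (auto simp: cube_def chan_def)

lemma wt_bounds:
  assumes "x \<in> cube" shows "0 \<le> wt r x" "wt r x \<le> 1" "0 \<le> wtx i r x" "wtx i r x \<le> 1"
  using chan_bounds[OF assms] by (auto simp: wt_def wtx_def intro!: prod_nonneg prod_le_1)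

lemma mix_bounds:
  assumes "x \<in> cube" shows "0 \<le> mix r x" "mix r x \<le> 1"
  using wt_bounds(1,2)[OF assms, of r] wt_bounds(1,2)[OF assms, of "- r"] by (auto simp: mix_def)

lemma wt_split: "wt r x = chan (r $ i) (x $ i) * wtx i r x"
  unfolding wt_def wtx_def by (rule prod.remove) auto

lemma X_bar_cube: "x \<in> X_bar \<Longrightarrow> x \<in> cube"
  unfolding X_bar_def X_dom_def X_bound_def X_bound_at_def cube_def
  by (auto simp: less_imp_le) (metis less_eq_real_def order_refl zero_le_one)+

lemma wt_pos_X_dom:
  assumes "x \<in> X_dom"
  shows "0 < wt r x"
  using assms by (auto simp: wt_def X_dom_def chan_def intro!: prod_pos)

text \<open>On such a face output \<open>i\<close> determines the input: exactly one of
  \<open>wt r x\<close> and \<open>wt (- r) x\<close> vanishes, and which one is decided by the test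
  in the definition of \<open>L_ratio\<close>.\<close>

lemma wt_X_bound_at:
  assumes "x \<in> X_bound_at i" "r \<in> sign_vectors"
  shows "0 < wtx i r x"
    "chan (r $ i) (x $ i) = (if (-1) ^ nat \<lfloor>x $ i\<rfloor> = r $ i then 0 else 1)"
    "chan ((- r) $ i) (x $ i) = (if (-1) ^ nat \<lfloor>x $ i\<rfloor> = r $ i then 1 else 0)"
  using assms sign_vectors_cases[OF assms(2), of i]
proof -
  have "0 < chan (r $ j) (x $ j)" if "j \<noteq> i" for j
    using assms(1) that by (auto simp: X_bound_at_def chan_def)
  then show "0 < wtx i r x" by (auto simp: wtx_def intro!: prod_pos)
qed (use assms sign_vectors_cases[OF assms(2), of i] in \<open>auto simp: X_bound_at_def chan_def\<close>)

lemma X_bound_at_unique: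
  assumes "x \<in> X_bound_at i" shows "(THE i. x \<in> X_bound_at i) = i" "x \<notin> X_dom"
proof -
  have "x \<in> X_bound_at j \<longrightarrow> j = i" for j
    using assms unfolding X_bound_at_def by (cases "j = i") force+
  then show "(THE i. x \<in> X_bound_at i) = i" using assms by blast
  show "x \<notin> X_dom"
    using assms unfolding X_bound_at_def X_dom_def by (metis (mono_tags, lifting) insertE less_irrefl mem_Collect_eq singletonD)
qed

lemma mix_pos:
  assumes "x \<in> X_bar" "r \<in> sign_vectors"
  shows "0 < mix r x"
proof (cases "x \<in> X_dom")
  case True
  then show ?thesis using wt_pos_X_dom[OF True, of r] wt_pos_X_dom[OF True, of "- r"] by (simp add: mix_def)
next
  case False
  then obtain i where i: "x \<in> X_bound_at i" using assms by (auto simp: X_bar_def X_bound_def)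
  have "0 < wtx i (- r) x" using wt_X_bound_at(1)[OF i, of "- r"] assms by simp
  then show ?thesis using wt_X_bound_at[OF i assms(2)]
    by (simp add: mix_def wt_split[of _ _ i])
qed

text \<open>Inside the cube the likelihood ratio is \<open>wt r x / wt (- r) x\<close>. Cleared of
  denominators, the expression stays meaningful on the boundary faces, where one weight is 0 and it
  takes the prescribed values -1 and 1.\<close>

lemma L_ratio_eq:
  assumes "x \<in> X_bar" "r \<in> sign_vectors"
  shows "L_ratio r x = (wt r x - wt (- r) x) / (wt r x + wt (- r) x)"
proof (cases "x \<in> X_dom")
  case True
  have "(x $ i / (1 - x $ i)) powi (r $ i) = chan (r $ i) (x $ i) / chan ((- r) $ i) (x $ i)" for i
    using sign_vectors_cases[OF assms(2), of i] True by (auto simp: chan_def X_dom_def power_int_minus)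
  then have "lik_ratio r x = wt r x / wt (- r) x"
    by (simp add: lik_ratio_def wt_def prod_dividef)
  then show ?thesis
    using True wt_pos_X_dom[OF True, of r] wt_pos_X_dom[OF True, of "- r"]
      divide_add_eq_iff[of "wt (- r) x" "wt r x" 1] divide_diff_eq_iff[of "wt (- r) x" "wt r x" 1]
    by (simp add: L_ratio_def)
next
  case False
  then obtain i where i: "x \<in> X_bound_at i" using assms by (auto simp: X_bar_def X_bound_def)
  have "0 < wtx i (- r) x" using wt_X_bound_at(1)[OF i, of "- r"] assms by simp
  then show ?thesis using wt_X_bound_at[OF i assms(2)] False
    by (simp add: L_ratio_def X_bound_at_unique[OF i] wt_split[of _ _ i])
qed

lemma f_tilde_eq:
  assumes "x \<in> X_bar" "r \<in> sign_vectors"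
  shows "f_tilde r x $ i = x $ i * (1 - x $ i) * score i r x"
proof -
  have pos: "wt r x + wt (- r) x > 0" using mix_pos[OF assms] by (simp add: mix_def)
  have "f_tilde r x $ i = 1/2 * (1 + (wt r x - wt (- r) x) / (wt r x + wt (- r) x) * of_int (r $ i)) - x $ i"
    by (simp add: f_tilde_def L_ratio_eq[OF assms])
  also have "\<dots> = ((wt r x + wt (- r) x) + (wt r x - wt (- r) x) * of_int (r $ i) - 2 * x $ i * (wt r x + wt (- r) x))
      / (2 * (wt r x + wt (- r) x))"
    using pos by (simp add: field_simps)
  \<comment> \<open>With coordinate \<open>i\<close> split off from both weights, everything without
    the factor \<open>x $ i * (1 - x $ i)\<close> cancels.\<close>
  also have "(wt r x + wt (- r) x) + (wt r x - wt (- r) x) * of_int (r $ i) - 2 * x $ i * (wt r x + wt (- r) x)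
     = 2 * (x $ i * (1 - x $ i)) * (of_int (r $ i) * (wtx i r x - wtx i (- r) x))"
    using sign_vectors_cases[OF assms(2), of i]
    by (auto simp: wt_split[of _ _ i] chan_def algebra_simps)
  finally show ?thesis by (simp add: score_def mix_def)
qed

lemma level_set_X_bar:
  assumes "\<delta> > 0" shows "level_set \<delta> \<subseteq> (X_bar :: (real ^ 'n::finite) set)"
proof
  fix x :: "real ^ 'n" assume x: "x \<in> level_set \<delta>"
  then have cube: "x \<in> cube" and pos: "\<And>r. r \<in> sign_vectors \<Longrightarrow> 0 < mix r x"
    using assms by (auto simp: level_set_def intro: less_le_trans)
  have one: "i = j" if i: "x $ i \<in> {0, 1}" and j: "x $ j \<in> {0, 1}" for i j
  proof (rule ccontr)
    assume "i \<noteq> j"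
    \<comment> \<open>A sign vector impossible under both inputs: it agrees with the input at i and not at j.\<close>
    define r :: "int ^ 'n" where
      "r = (\<chi> k. if k = i then (if x $ i = 0 then 1 else -1) else (if x $ j = 0 then -1 else 1))"
    have "r \<in> sign_vectors" by (auto simp: r_def sign_vectors_def)
    moreover have "wt r x = 0"
      using i by (auto simp: wt_def chan_def r_def intro!: exI[of _ i])
    moreover have "wt (- r) x = 0"
      using j \<open>i \<noteq> j\<close> by (auto simp: wt_def chan_def r_def intro!: exI[of _ j])
    ultimately show False using pos[of r] by (simp add: mix_def)
  qed
  show "x \<in> X_bar"
  proof (cases "\<exists>i. x $ i \<in> {0, 1}")
    case True
    then obtain i where i: "x $ i \<in> {0, 1}" by blast
    have "0 < x $ j \<and> x $ j < 1" if "j \<noteq> i" for j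
      using one[OF i, of j] cube that unfolding cube_def by (force simp: less_le)
    then show ?thesis using i by (auto simp: X_bar_def X_bound_def X_bound_at_def)
  next
    case False
    then show ?thesis using cube unfolding cube_def X_bar_def X_dom_def by (force simp: less_le)
  qed
qed

lemma score_bound:
  assumes "\<delta> > 0" "x \<in> level_set \<delta>" "r \<in> sign_vectors"
  shows "\<bar>score i r x\<bar> \<le> 1 / \<delta>"
proof -
  have m: "\<delta> \<le> mix r x" and c: "x \<in> cube" using assms by (auto simp: level_set_def)
  have "\<bar>score i r x\<bar> = \<bar>wtx i r x - wtx i (- r) x\<bar> / (2 * mix r x)"
    using sign_vectors_cases[OF assms(3), of i] m assms(1) by (auto simp: score_def abs_mult)
  also have "\<dots> \<le> 1 / \<delta>"
    using wt_bounds(3,4)[OF c, of i r] wt_bounds(3,4)[OF c, of i "- r"] m assms(1)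
    by (intro frac_le) (auto simp: abs_le_iff)
  finally show ?thesis .
qed

section \<open>One-step expansion of the log-likelihood\<close>

text \<open>Induction on \<open>A\<close>: a new factor at most doubles the error and adds a term of
  size \<open>card A * b^2\<close>. The base 4 absorbs both, because \<open>card A\<close> is at
  most \<open>2 * 4 ^ card A\<close>.\<close>

lemma prod_one_plus_expansion:
  fixes z :: "'a \<Rightarrow> real"
  assumes "finite A" "\<And>i. i \<in> A \<Longrightarrow> \<bar>z i\<bar> \<le> b" "0 \<le> b" "b \<le> 1"
  shows "\<bar>(\<Prod>i\<in>A. 1 + z i) - 1 - (\<Sum>i\<in>A. z i)\<bar> \<le> 4 ^ card A * b\<^sup>2"
  using assms(1,2)
proof (induction A rule: finite_induct)
  case (insert a A)
  define P where "P = (\<Prod>i\<in>A. 1 + z i)"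
  define T where "T = (\<Sum>i\<in>A. z i)"
  have IH: "\<bar>P - 1 - T\<bar> \<le> 4 ^ card A * b\<^sup>2" using insert by (simp add: P_def T_def)
  have za: "\<bar>z a\<bar> \<le> b" using insert by simp
  have "\<bar>T\<bar> \<le> (\<Sum>i\<in>A. b)" unfolding T_def using insert by (intro order_trans[OF sum_abs] sum_mono) auto
  then have T: "\<bar>T\<bar> \<le> card A * b" by simp
  have e1: "\<bar>z a * T\<bar> \<le> b * (card A * b)" unfolding abs_mult using za T assms by (intro mult_mono) auto
  have e2: "\<bar>z a * (P - 1 - T)\<bar> \<le> 1 * (4 ^ card A * b\<^sup>2)"
    unfolding abs_mult using za IH assms by (intro mult_mono) auto
  have "card A \<le> 4 ^ card A"
    using less_exp[of "card A"] power_mono[of 2 "4::nat" "card A"] by linarith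
  then have "real (card A) \<le> real (4 ^ card A)" by (rule of_nat_mono)
  then have "real (card A) \<le> 4 ^ card A" by simp
  moreover have "(0::real) \<le> 4 ^ card A" by simp
  ultimately have "real (card A) \<le> 2 * 4 ^ card A" by linarith
  then have e3: "card A * b\<^sup>2 \<le> 2 * 4 ^ card A * b\<^sup>2" by (intro mult_right_mono) auto
  have "(1 + z a) * P - 1 - (z a + T) = (P - 1 - T) + z a * T + z a * (P - 1 - T)"
    by (simp add: algebra_simps)
  then have "\<bar>(1 + z a) * P - 1 - (z a + T)\<bar> \<le> 4 ^ card A * b\<^sup>2 + b * (card A * b) + 4 ^ card A * b\<^sup>2"
    using IH e1 e2 by linarith
  also have "\<dots> \<le> 4 ^ card (insert a A) * b\<^sup>2"
    using e3 insert(1,2) by (simp add: power2_eq_square algebra_simps)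
  finally show ?case using insert by (simp add: P_def T_def)
qed simp


definition log_lik :: "real ^ 'n::finite \<Rightarrow> real ^ 'n \<Rightarrow> real" where
  "log_lik \<pi> x = (\<Sum>r\<in>sign_vectors. g_law \<pi> r * ln (mix r x))"

text \<open>The i-th partial derivative of \<open>log_lik \<pi>\<close> wherever all
  \<open>mix r x\<close> are positive.\<close>

definition mean_score :: "real ^ 'n::finite \<Rightarrow> 'n \<Rightarrow> real ^ 'n \<Rightarrow> real" where
  "mean_score \<pi> i x = (\<Sum>r\<in>sign_vectors. g_law \<pi> r * score i r x)"

definition drift :: "real ^ 'n::finite \<Rightarrow> real ^ 'n \<Rightarrow> real" where
  "drift \<pi> x = (\<Sum>i\<in>UNIV. x $ i * (1 - x $ i) * (mean_score \<pi> i x)\<^sup>2)"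

text \<open>First-order change of the log-likelihood per unit step size when \<open>r\<close> is
  observed, centred by its mean, the drift.\<close>

definition noise :: "real ^ 'n::finite \<Rightarrow> int ^ 'n \<Rightarrow> real ^ 'n \<Rightarrow> real" where
  "noise \<pi> r x = (\<Sum>i\<in>UNIV. x $ i * (1 - x $ i) * score i r x * mean_score \<pi> i x) - drift \<pi> x"

lemma wt_mult_one_plus:
  assumes "\<And>i. chan (r $ i) (y $ i) = chan (r $ i) (x $ i) * (1 + z i)"
  shows "wt r y = wt r x * (\<Prod>i\<in>UNIV. 1 + z i)"
  unfolding wt_def assms prod.distrib ..

context
  fixes \<delta> \<eta> :: real and x y :: "real ^ 'n::finite" and r :: "int ^ 'n"
  assumes \<delta>: "\<delta> > 0" and \<eta>: "0 < \<eta>" "\<eta> \<le> \<delta>" and x: "x \<in> level_set \<delta>" and r: "r \<in> sign_vectors"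
    and y: "y = x + \<eta> *\<^sub>R f_tilde r x"
begin

text \<open>Relative change of the i-th factor of \<open>wt s\<close> per unit step size, for the
  step driven by \<open>r\<close>. The update carries the factor \<open>x $ i * (1 - x $ i)\<close>,
  hence a factor that is 0 stays 0, and boundary faces need no separate treatment.\<close>

definition rel :: "int ^ 'n \<Rightarrow> 'n \<Rightarrow> real" where
  "rel s i = of_int (s $ i) * (1 - chan (s $ i) (x $ i)) * score i r x"

lemma chan_step:
  assumes "s \<in> sign_vectors"
  shows "chan (s $ i) (y $ i) = chan (s $ i) (x $ i) * (1 + \<eta> * rel s i)"
proof -
  have "y $ i = x $ i + \<eta> * (x $ i * (1 - x $ i) * score i r x)"
    using f_tilde_eq[of x r i] level_set_X_bar[OF \<delta>] x r by (auto simp: y)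
  then show ?thesis
    using sign_vectors_cases[OF assms, of i] by (auto simp: chan_def rel_def algebra_simps)
qed

lemma rel_bound:
  assumes "s \<in> sign_vectors"
  shows "\<bar>\<eta> * rel s i\<bar> \<le> \<eta> / \<delta>" "\<eta> / \<delta> \<le> 1"
proof -
  have c: "x \<in> cube" using x by (auto simp: level_set_def)
  have "\<bar>rel s i\<bar> \<le> 1 * (1 / \<delta>)"
    unfolding rel_def abs_mult
    using sign_vectors_cases[OF assms, of i] chan_bounds[OF c, of "s $ i" i] score_bound[OF \<delta> x r]
    by (intro mult_mono) auto
  then show "\<bar>\<eta> * rel s i\<bar> \<le> \<eta> / \<delta>" using \<eta> mult_left_mono[of "\<bar>rel s i\<bar>" "1 / \<delta>" \<eta>]
    by (simp add: abs_mult)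
  show "\<eta> / \<delta> \<le> 1" using \<eta> \<delta> by simp
qed

lemma step_cube: "y \<in> cube"
proof -
  have "0 \<le> chan (s $ i) (y $ i)" if "s \<in> sign_vectors" for s i
    using rel_bound(1)[OF that, of i] rel_bound(2)[OF that] chan_step[OF that, of i] chan_bounds[of x "s $ i" i] x
    by (auto simp: level_set_def)
  \<comment> \<open>The vector of ones gives the lower bounds 0, the vector of minus ones the upper
    bounds 1.\<close>
  from this[of "\<chi> i. 1"] this[of "\<chi> i. -1"] show ?thesis
    by (auto simp: cube_def chan_def sign_vectors_def)
qed

text \<open>The derivative of \<open>ln (mix s)\<close> at \<open>x\<close> in the direction
  \<open>f_tilde r x\<close>.\<close>

definition gain :: "int ^ 'n \<Rightarrow> real" where
  "gain s = (\<Sum>i\<in>UNIV. x $ i * (1 - x $ i) * score i r x * score i s x)"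

text \<open>Both weights are multiplied by products of factors \<open>1 + \<eta> * rel\<close>, so
  the error is proportional to \<open>mix s x\<close> itself. This relative form is what permits
  passing to logarithms.\<close>

lemma mix_step:
  assumes s: "s \<in> sign_vectors"
  shows "\<bar>mix s y - mix s x - \<eta> * (mix s x * gain s)\<bar> \<le> mix s x * (4 ^ CARD('n) * (\<eta> / \<delta>)\<^sup>2)"
proof -
  have c: "x \<in> cube" and pos: "mix s x > 0" using x s \<delta> by (auto simp: level_set_def intro: less_le_trans)
  have ms: "- s \<in> sign_vectors" using s by simp
  have W: "\<bar>wt t y - wt t x - \<eta> * (wt t x * (\<Sum>i\<in>UNIV. rel t i))\<bar> \<le> wt t x * (4 ^ CARD('n) * (\<eta> / \<delta>)\<^sup>2)"
    if t: "t \<in> sign_vectors" for t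
  proof -
    have "wt t y - wt t x - \<eta> * (wt t x * (\<Sum>i\<in>UNIV. rel t i))
        = wt t x * ((\<Prod>i\<in>UNIV. 1 + \<eta> * rel t i) - 1 - (\<Sum>i\<in>UNIV. \<eta> * rel t i))"
      using wt_mult_one_plus[of t y x "\<lambda>i. \<eta> * rel t i"] chan_step[OF t]
      by (simp add: algebra_simps sum_distrib_left)
    moreover have "\<bar>(\<Prod>i\<in>UNIV. 1 + \<eta> * rel t i) - 1 - (\<Sum>i\<in>UNIV. \<eta> * rel t i)\<bar> \<le> 4 ^ CARD('n) * (\<eta> / \<delta>)\<^sup>2"
      using rel_bound[OF t] \<eta> \<delta> by (intro prod_one_plus_expansion) auto
    ultimately show ?thesis
      using wt_bounds(1)[OF c, of t] by (simp add: abs_mult mult_left_mono)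
  qed
  \<comment> \<open>The first-order terms belonging to the two inputs combine to the numerator of
    \<open>score i s x\<close>.\<close>
  have G: "wt s x * rel s i + wt (- s) x * rel (- s) i = 2 * mix s x * (x $ i * (1 - x $ i) * score i r x * score i s x)" for i
  proof -
    have "2 * mix s x * score i s x = of_int (s $ i) * (wtx i s x - wtx i (- s) x)"
      using pos by (simp add: score_def)
    moreover have "wt s x * rel s i + wt (- s) x * rel (- s) i
      = x $ i * (1 - x $ i) * score i r x * (of_int (s $ i) * (wtx i s x - wtx i (- s) x))"
      using sign_vectors_cases[OF s, of i]
      by (auto simp: wt_split[of _ _ i] rel_def chan_def algebra_simps)
    ultimately show ?thesis by (metis mult.assoc mult.commute)
  qed
  have "wt s x * (\<Sum>i\<in>UNIV. rel s i) + wt (- s) x * (\<Sum>i\<in>UNIV. rel (- s) i) = 2 * (mix s x * gain s)"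
    unfolding gain_def sum_distrib_left sum.distrib[symmetric] G by (simp add: mult.assoc)
  then have "\<eta> * (wt s x * (\<Sum>i\<in>UNIV. rel s i)) + \<eta> * (wt (- s) x * (\<Sum>i\<in>UNIV. rel (- s) i)) = 2 * (\<eta> * (mix s x * gain s))"
    by (simp add: distrib_left[symmetric])
  moreover have "wt s x * (4 ^ CARD('n) * (\<eta> / \<delta>)\<^sup>2) + wt (- s) x * (4 ^ CARD('n) * (\<eta> / \<delta>)\<^sup>2)
     = 2 * (mix s x * (4 ^ CARD('n) * (\<eta> / \<delta>)\<^sup>2))"
    by (simp add: mix_def distrib_right)
  moreover have "mix s y = (wt s y + wt (- s) y) / 2" "mix s x = (wt s x + wt (- s) x) / 2"
    by (simp_all add: mix_def)
  moreover have average: "\<bar>(a + b) / 2 - (a' + b') / 2 - d\<bar> \<le> k"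
    if "\<bar>a - a' - p\<bar> \<le> l" "\<bar>b - b' - q\<bar> \<le> l'" "p + q = 2 * d" "l + l' = 2 * k" for a b a' b' p q d l l' k :: real
    using that unfolding abs_le_iff by (simp add: field_simps)
  ultimately show ?thesis using average[OF W[OF s] W[OF ms]] by metis
qed

lemma gain_bound:
  assumes s: "s \<in> sign_vectors"
  shows "\<bar>gain s\<bar> \<le> CARD('n) / \<delta>\<^sup>2"
proof -
  have c: "x \<in> cube" using x by (auto simp: level_set_def)
  have "\<bar>x $ i * (1 - x $ i) * score i r x * score i s x\<bar> \<le> 1 * 1 * (1 / \<delta>) * (1 / \<delta>)" for i
    unfolding abs_mult using c score_bound[OF \<delta> x r, of i] score_bound[OF \<delta> x s, of i] \<delta>
    by (intro mult_mono) (auto simp: cube_def)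
  then have "\<bar>gain s\<bar> \<le> (\<Sum>i\<in>(UNIV::'n set). 1 / \<delta>\<^sup>2)"
    unfolding gain_def by (intro order_trans[OF sum_abs] sum_mono) (simp add: power2_eq_square)
  then show ?thesis by simp
qed

text \<open>Let \<open>u\<close> be the relative change of \<open>mix s\<close>. The constant
  \<open>c\<close> adds those of \<open>gain_bound\<close> and \<open>mix_step\<close>, so that
  \<bar>\<open>u\<close>\<bar> \<le> \<open>c * \<eta>\<close> \<le> 1/2. Then \<open>mix s\<close>
  loses at most half, and \<open>ln (1 + u)\<close> differs from \<open>u\<close> by at most
  \<open>2 * u^2\<close>, which is the source of \<open>2 * c^2\<close> in the error.\<close>

lemma ln_mix_step:
  defines "c \<equiv> (CARD('n) + 4 ^ CARD('n)) / \<delta>\<^sup>2"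
  assumes s: "s \<in> sign_vectors" and small: "\<eta> \<le> 1" "c * \<eta> \<le> 1 / 2"
  shows "mix s x / 2 \<le> mix s y" "ln (mix s y) \<ge> ln (mix s x) + \<eta> * gain s - (c + 2 * c\<^sup>2) * \<eta>\<^sup>2"
proof -
  have pos: "mix s x > 0" using x s \<delta> by (auto simp: level_set_def intro: less_le_trans)
  define u where "u = mix s y / mix s x - 1"
  have mu: "mix s y = mix s x * (1 + u)" using pos by (simp add: u_def)
  have "mix s x * \<bar>u - \<eta> * gain s\<bar> \<le> mix s x * (4 ^ CARD('n) * (\<eta> / \<delta>)\<^sup>2)"
  proof -
    have "mix s x * \<bar>u - \<eta> * gain s\<bar> = \<bar>mix s x * (u - \<eta> * gain s)\<bar>" using pos by (simp add: abs_mult)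
    also have "mix s x * (u - \<eta> * gain s) = mix s y - mix s x - \<eta> * (mix s x * gain s)"
      unfolding mu by (simp add: algebra_simps)
    finally show ?thesis using mix_step[OF s] by simp
  qed
  from mult_left_le_imp_le[OF this pos] have u: "\<bar>u - \<eta> * gain s\<bar> \<le> (4 ^ CARD('n) / \<delta>\<^sup>2) * \<eta>\<^sup>2"
    by (simp add: power_divide)
  have "(4 ^ CARD('n) / \<delta>\<^sup>2) * \<eta>\<^sup>2 \<le> (4 ^ CARD('n) / \<delta>\<^sup>2) * \<eta>"
    using small(1) \<eta>(1) by (intro mult_left_mono) (auto simp: power2_eq_square intro: mult_left_le)
  moreover have "\<bar>\<eta> * gain s\<bar> \<le> \<eta> * (CARD('n) / \<delta>\<^sup>2)"
    unfolding abs_mult using \<eta> gain_bound[OF s] by (intro mult_mono) auto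
  moreover have "(4 ^ CARD('n) / \<delta>\<^sup>2) * \<eta> + \<eta> * (CARD('n) / \<delta>\<^sup>2) = c * \<eta>"
    by (simp add: c_def add_divide_distrib algebra_simps)
  ultimately have uc: "\<bar>u\<bar> \<le> c * \<eta>" using u by linarith
  then have uh: "\<bar>u\<bar> \<le> 1 / 2" using small(2) by linarith
  have "mix s x * (1 / 2) \<le> mix s x * (1 + u)" using pos uh by (intro mult_left_mono) auto
  then show "mix s x / 2 \<le> mix s y" by (simp add: mu)
  have "\<bar>ln (1 + u) - u\<bar> \<le> 2 * u\<^sup>2" using uh by (rule abs_ln_one_plus_x_minus_x_bound)
  moreover have "u\<^sup>2 \<le> (c * \<eta>)\<^sup>2" using uc by (metis abs_ge_zero power2_abs power_mono)
  moreover have "(4 ^ CARD('n) / \<delta>\<^sup>2) * \<eta>\<^sup>2 \<le> c * \<eta>\<^sup>2"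
    using \<delta> by (intro mult_right_mono) (auto simp: c_def divide_right_mono)
  moreover have "ln (mix s y) = ln (mix s x) + ln (1 + u)"
    unfolding mu using pos uh by (intro ln_mult_pos) auto
  moreover have "(c + 2 * c\<^sup>2) * \<eta>\<^sup>2 = c * \<eta>\<^sup>2 + 2 * (c * \<eta>)\<^sup>2"
    by (simp add: power_mult_distrib algebra_simps)
  ultimately show "ln (mix s y) \<ge> ln (mix s x) + \<eta> * gain s - (c + 2 * c\<^sup>2) * \<eta>\<^sup>2"
    using u by linarith
qed

end

lemma g_law_pos: "(\<And>i. 0 < \<pi> $ i \<and> \<pi> $ i < 1) \<Longrightarrow> r \<in> sign_vectors \<Longrightarrow> 0 < g_law \<pi> r"
  using mix_pos[of \<pi> r] by (simp add: g_law_eq_mix X_bar_def X_dom_def)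

lemma sum_g_law: "(\<Sum>r\<in>sign_vectors. g_law \<pi> r) = 1"
  using sum_mix[of \<pi>] by (simp add: g_law_eq_mix)

text \<open>Averages \<open>ln_mix_step\<close> over \<open>s\<close> under the true law; the
  constants depend on \<open>\<delta>\<close> and the dimension only, so they are uniform over the
  level set.\<close>

lemma log_lik_step:
  fixes \<pi> :: "real ^ 'n::finite"
  assumes \<pi>: "\<And>i. 0 < \<pi> $ i \<and> \<pi> $ i < 1" and \<delta>: "\<delta> > 0"
  obtains C \<eta>0 where "C \<ge> 0" "\<eta>0 > 0"
    "\<And>x r \<eta>. x \<in> level_set \<delta> \<Longrightarrow> r \<in> sign_vectors \<Longrightarrow> 0 < \<eta> \<Longrightarrow> \<eta> \<le> \<eta>0 \<Longrightarrow>
      x + \<eta> *\<^sub>R f_tilde r x \<in> level_set (\<delta> / 2) \<and>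
      log_lik \<pi> (x + \<eta> *\<^sub>R f_tilde r x) \<ge> log_lik \<pi> x + \<eta> * (drift \<pi> x + noise \<pi> r x) - C * \<eta>\<^sup>2"
proof -
  define c where "c = (CARD('n) + 4 ^ CARD('n)) / \<delta>\<^sup>2"
  have c0: "c > 0" using \<delta> by (auto simp: c_def intro!: divide_pos_pos add_pos_pos)
  define C where "C = c + 2 * c\<^sup>2"
  \<comment> \<open>The bound \<open>\<delta>\<close> keeps the step in the cube, the other two are
    the smallness conditions of \<open>ln_mix_step\<close>.\<close>
  define \<eta>0 where "\<eta>0 = min \<delta> (min 1 (1 / (2 * c)))"
  show thesis
  proof (rule that[of C \<eta>0])
    show "C \<ge> 0" "\<eta>0 > 0" using c0 \<delta> by (auto simp: C_def \<eta>0_def)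
    fix x :: "real ^ 'n" and r :: "int ^ 'n" and \<eta> assume x: "x \<in> level_set \<delta>" and r: "r \<in> sign_vectors" and \<eta>: "0 < \<eta>" "\<eta> \<le> \<eta>0"
    define y where "y = x + \<eta> *\<^sub>R f_tilde r x"
    have \<eta>': "\<eta> \<le> \<delta>" "\<eta> \<le> 1" "c * \<eta> \<le> 1 / 2" using \<eta> c0 by (auto simp: \<eta>0_def field_simps)
    note step = ln_mix_step[OF \<delta> \<eta>(1) \<eta>'(1) x r y_def _ \<eta>'(2), folded c_def, OF _ \<eta>'(3)]
    have "y \<in> level_set (\<delta> / 2)"
      using step_cube[OF \<delta> \<eta>(1) \<eta>'(1) x r y_def] step(1) x unfolding level_set_def by force
    moreover have "log_lik \<pi> y \<ge> log_lik \<pi> x + \<eta> * (drift \<pi> x + noise \<pi> r x) - C * \<eta>\<^sup>2"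
    proof -
      \<comment> \<open>Averaging over \<open>s\<close> turns \<open>score i s x\<close> into
        \<open>mean_score \<pi> i x\<close>, while the score at the observed \<open>r\<close>
        remains.\<close>
      have "(\<Sum>s\<in>sign_vectors. g_law \<pi> s * gain x r s)
          = (\<Sum>s\<in>sign_vectors. \<Sum>i\<in>UNIV. x $ i * (1 - x $ i) * score i r x * (g_law \<pi> s * score i s x))"
        by (simp add: gain_def[OF \<delta> \<eta>(1) \<eta>'(1) x r y_def] sum_distrib_left algebra_simps)
      also have "\<dots> = drift \<pi> x + noise \<pi> r x"
        by (subst sum.swap) (simp add: noise_def mean_score_def sum_distrib_left)
      finally have D: "(\<Sum>s\<in>sign_vectors. g_law \<pi> s * gain x r s) = drift \<pi> x + noise \<pi> r x" .
      have "log_lik \<pi> x + \<eta> * (drift \<pi> x + noise \<pi> r x) - C * \<eta>\<^sup>2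
          = (\<Sum>s\<in>sign_vectors. g_law \<pi> s * (ln (mix s x) + \<eta> * gain x r s - C * \<eta>\<^sup>2))"
        by (simp add: D[symmetric] log_lik_def algebra_simps sum.distrib sum_subtractf sum_distrib_left[symmetric]
              sum_distrib_right[symmetric] sum_g_law)
      also have "\<dots> \<le> log_lik \<pi> y"
        unfolding log_lik_def using step(2) less_imp_le[OF g_law_pos[OF \<pi>]]
        by (intro sum_mono mult_left_mono) (auto simp: C_def)
      finally show ?thesis .
    qed
    ultimately show "x + \<eta> *\<^sub>R f_tilde r x \<in> level_set (\<delta> / 2) \<and>
      log_lik \<pi> (x + \<eta> *\<^sub>R f_tilde r x) \<ge> log_lik \<pi> x + \<eta> * (drift \<pi> x + noise \<pi> r x) - C * \<eta>\<^sup>2"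
      by (simp add: y_def)
  qed
qed


section \<open>Compact level sets and zeros of the drift\<close>

lemma continuous_on_chan [continuous_intros]: "continuous_on S (\<lambda>x. chan s (x $ i))"
  unfolding chan_def by (cases "s = 1") (auto intro!: continuous_intros)

lemma continuous_on_wt [continuous_intros]: "continuous_on S (wt r)"
  unfolding wt_def by (intro continuous_intros)

lemma continuous_on_wtx [continuous_intros]: "continuous_on S (wtx i r)"
  unfolding wtx_def by (intro continuous_intros)

lemma continuous_on_mix [continuous_intros]: "continuous_on S (mix r)"
  unfolding mix_def by (intro continuous_intros) auto

lemma compact_cube: "compact (cube :: (real ^ 'n::finite) set)"
proof -
  have "cube = cbox (0 :: real ^ 'n) (\<chi> i. 1)"
    by (auto simp: cube_def mem_box_cart)
  then show ?thesis using compact_cbox by metis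
qed

lemma compact_level_set: "compact (level_set \<delta> :: (real ^ 'n::finite) set)"
proof -
  have "closed {x. \<delta> \<le> mix r x}" for r :: "int ^ 'n"
    by (intro closed_Collect_le continuous_intros)
  then have "closed (\<Inter>r\<in>sign_vectors. {x. \<delta> \<le> mix r (x :: real ^ 'n)})" by blast
  moreover have "level_set \<delta> = cube \<inter> (\<Inter>r\<in>sign_vectors. {x. \<delta> \<le> mix r (x :: real ^ 'n)})"
    by (auto simp: level_set_def)
  ultimately show ?thesis using compact_Int_closed[OF compact_cube] by metis
qed

lemma level_set_mono: "\<delta> \<le> \<delta>' \<Longrightarrow> level_set \<delta>' \<subseteq> level_set \<delta>"
  unfolding level_set_def by force

text \<open>Each of the finitely many functions \<open>mix r\<close> is continuous and positive on
  \<open>C\<close>, hence bounded below there by a positive constant.\<close>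

lemma compact_subset_level_set:
  fixes C :: "(real ^ 'n::finite) set"
  assumes "compact C" "C \<subseteq> X_bar"
  obtains \<delta> where "\<delta> > 0" "C \<subseteq> level_set \<delta>"
proof -
  have "\<exists>d>0. \<forall>x\<in>C. d \<le> mix r x" if r: "r \<in> sign_vectors" for r
  proof (cases "C = {}")
    case False
    then obtain z where "z \<in> C" "\<forall>x\<in>C. mix r z \<le> mix r x"
      using continuous_attains_inf[OF assms(1) _ continuous_on_mix] by blast
    then show ?thesis using mix_pos[of z r] assms(2) r by blast
  qed (auto intro: exI[of _ 1])
  then obtain d where d: "\<And>r. r \<in> sign_vectors \<Longrightarrow> d r > 0 \<and> (\<forall>x\<in>C. d r \<le> mix r x)" by metis
  define \<delta> where "\<delta> = Min (insert 1 (d ` sign_vectors))"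
  have "\<delta> > 0" using d unfolding \<delta>_def by (subst Min_gr_iff) auto
  moreover have "\<delta> \<le> d r" if "r \<in> sign_vectors" for r using that unfolding \<delta>_def by (intro Min_le) auto
  then have "C \<subseteq> level_set \<delta>"
    using assms(2) X_bar_cube d unfolding level_set_def by force
  ultimately show ?thesis using that by blast
qed

lemma continuous_on_score:
  assumes "\<delta> > 0" "r \<in> sign_vectors"
  shows "continuous_on (level_set \<delta>) (score i r)"
  unfolding score_def using assms
  by (intro continuous_intros) (force simp: level_set_def)

lemma continuous_on_drift:
  assumes "\<delta> > 0"
  shows "continuous_on (level_set \<delta>) (drift \<pi>)"
  unfolding drift_def mean_score_def using continuous_on_score[OF assms]
  by (intro continuous_intros) auto

lemma drift_nonneg: "x \<in> cube \<Longrightarrow> 0 \<le> drift \<pi> x"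
  unfolding drift_def cube_def by (intro sum_nonneg mult_nonneg_nonneg) auto

lemma mean_field_eq:
  assumes "x \<in> X_bar"
  shows "mean_field \<pi> x $ i = x $ i * (1 - x $ i) * mean_score \<pi> i x"
proof -
  have "mean_field \<pi> x $ i = (\<Sum>r\<in>sign_vectors. g_law \<pi> r * f_tilde r x $ i)"
    by (simp add: mean_field_def)
  also have "\<dots> = (\<Sum>r\<in>sign_vectors. x $ i * (1 - x $ i) * (g_law \<pi> r * score i r x))"
    by (rule sum.cong) (simp_all add: f_tilde_eq[OF assms] mult_ac)
  finally show ?thesis by (simp only: mean_score_def sum_distrib_left)
qed

text \<open>On this face \<open>L_ratio r x\<close> is \<open>r $ i\<close> up to a fixed sign,
  since output \<open>i\<close> is taken to reveal the input. So the update of coordinate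
  \<open>j\<close> is affine in \<open>r $ i * r $ j\<close>, and only the correlation of the two
  outputs under \<open>\<pi>\<close> enters.\<close>

lemma mean_field_X_bound_at:
  fixes \<pi> :: "real ^ 'n::finite"
  assumes x: "x \<in> X_bound_at i" and "i \<noteq> j"
  shows "mean_field \<pi> x $ j = (1 - x $ i) * h_bsc (\<pi> $ i) (1 - \<pi> $ j) + x $ i * h_bsc (\<pi> $ i) (\<pi> $ j) - x $ j"
proof -
  have xi: "x $ i = 0 \<or> x $ i = 1" using x by (auto simp: X_bound_at_def)
  have L: "L_ratio r x = (2 * x $ i - 1) * of_int (r $ i)" if "r \<in> sign_vectors" for r
    using sign_vectors_cases[OF that, of i] xi
    by (auto simp: L_ratio_def X_bound_at_unique[OF x])
  have "mean_field \<pi> x $ j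
      = (\<Sum>r\<in>sign_vectors. (1/2 - x $ j) * mix r \<pi> + (2 * x $ i - 1) / 2 * (mix r \<pi> * of_int (r $ i * r $ j)))"
    unfolding mean_field_def
    by (simp add: f_tilde_def g_law_eq_mix L algebra_simps cong: sum.cong) (simp add: algebra_simps add_divide_distrib diff_divide_distrib)
  also have "\<dots> = (1/2 - x $ j) * (\<Sum>r\<in>sign_vectors. mix r \<pi>)
      + (2 * x $ i - 1) / 2 * (\<Sum>r\<in>sign_vectors. mix r \<pi> * of_int (r $ i * r $ j))"
    by (simp only: sum.distrib sum_distrib_left)
  also have "\<dots> = (1/2 - x $ j) + (2 * x $ i - 1) / 2 * ((2 * \<pi> $ i - 1) * (2 * \<pi> $ j - 1))"
    by (simp only: sum_mix sum_mix_correlation[OF assms(2)]) simp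
  also have "\<dots> = (1 - x $ i) * h_bsc (\<pi> $ i) (1 - \<pi> $ j) + x $ i * h_bsc (\<pi> $ i) (\<pi> $ j) - x $ j"
    using xi by (auto simp: h_bsc_def field_simps)
  finally show ?thesis .
qed

text \<open>All summands of the drift are nonnegative, so each vanishes, and with it each component
  of the mean field. On a face component \<open>i\<close> vanishes by itself, and the others are the
  equations of \<open>E_boundary\<close>.\<close>

lemma drift_zero_imp_E_bar:
  assumes "x \<in> X_bar" "drift \<pi> x = 0"
  shows "x \<in> E_bar \<pi>"
proof -
  have c: "x \<in> cube" using assms X_bar_cube by blast
  have "x $ i * (1 - x $ i) * (mean_score \<pi> i x)\<^sup>2 = 0" for i
    using assms(2) c unfolding drift_def
    by (subst (asm) sum_nonneg_eq_0_iff) (auto simp: cube_def)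
  then have "mean_field \<pi> x $ i = 0" for i
    unfolding mean_field_eq[OF assms(1)] by (metis mult_eq_0_iff power_eq_0_iff)
  then have f: "mean_field \<pi> x = 0" by (simp add: vec_eq_iff)
  show ?thesis
  proof (cases "x \<in> X_dom")
    case True
    then show ?thesis using f by (simp add: E_bar_def E_int_def)
  next
    case False
    then obtain i where i: "x \<in> X_bound_at i" using assms by (auto simp: X_bar_def X_bound_def)
    have "x $ j = (1 - x $ i) * h_bsc (\<pi> $ i) (1 - \<pi> $ j) + x $ i * h_bsc (\<pi> $ i) (\<pi> $ j)" if "j \<noteq> i" for j
      using mean_field_X_bound_at[OF i, of j \<pi>] that f by auto
    moreover have "x $ i \<in> {0, 1}" "x \<in> X_bound" using i by (auto simp: X_bound_at_def X_bound_def)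
    ultimately show ?thesis unfolding E_bar_def E_boundary_def by blast
  qed
qed

section \<open>Superlevel sets and uniform bounds\<close>

lemma log_lik_nonpos:
  assumes "\<And>i. 0 < \<pi> $ i \<and> \<pi> $ i < 1" "x \<in> X_bar"
  shows "log_lik \<pi> x \<le> 0"
  unfolding log_lik_def
  using less_imp_le[OF g_law_pos[OF assms(1)]] mix_pos[OF assms(2)] mix_bounds[OF X_bar_cube[OF assms(2)]]
  by (intro sum_nonpos mult_nonneg_nonpos) auto

text \<open>All summands of \<open>log_lik\<close> are nonpositive, so a lower bound
  \<open>c\<close> on the sum bounds each of them. Dividing by the least true probability
  \<open>m\<close> gives \<open>ln (mix r x)\<close> \<ge> \<open>c / m\<close>.\<close>

lemma log_lik_superlevel:
  fixes \<pi> :: "real ^ 'n::finite"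
  assumes \<pi>: "\<And>i. 0 < \<pi> $ i \<and> \<pi> $ i < 1"
  obtains \<delta> where "\<delta> > 0" "\<And>x. x \<in> X_bar \<Longrightarrow> c \<le> log_lik \<pi> x \<Longrightarrow> x \<in> level_set \<delta>"
proof -
  define m where "m = Min (insert 1 (g_law \<pi> ` sign_vectors))"
  have m: "m > 0" using g_law_pos[OF \<pi>] unfolding m_def by (subst Min_gr_iff) auto
  have ml: "m \<le> g_law \<pi> r" if "r \<in> sign_vectors" for r using that unfolding m_def by (intro Min_le) auto
  have "x \<in> level_set (exp (c / m))" if x: "x \<in> X_bar" and ll: "c \<le> log_lik \<pi> x" for x
  proof -
    have "exp (c / m) \<le> mix r x" if r: "r \<in> sign_vectors" for r
    proof -
      have neg: "ln (mix s x) \<le> 0" if "s \<in> sign_vectors" for s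
        using mix_pos[OF x that] mix_bounds[OF X_bar_cube[OF x], of s] by simp
      have "log_lik \<pi> x = g_law \<pi> r * ln (mix r x) + (\<Sum>s\<in>sign_vectors - {r}. g_law \<pi> s * ln (mix s x))"
        unfolding log_lik_def using r by (intro sum.remove) auto
      also have "(\<Sum>s\<in>sign_vectors - {r}. g_law \<pi> s * ln (mix s x)) \<le> 0"
        using neg less_imp_le[OF g_law_pos[OF \<pi>]] by (intro sum_nonpos mult_nonneg_nonpos) auto
      also have "g_law \<pi> r * ln (mix r x) \<le> m * ln (mix r x)"
        using ml[OF r] neg[OF r] by (rule mult_right_mono_neg)
      finally have "c / m \<le> ln (mix r x)" using ll m by (simp add: field_simps)
      then show ?thesis using mix_pos[OF x r] by (simp add: ln_ge_iff)
    qed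
    then show ?thesis using X_bar_cube[OF x] by (simp add: level_set_def)
  qed
  then show thesis using that[of "exp (c / m)"] by simp
qed

lemma norm_f_tilde_le:
  fixes x :: "real ^ 'n::finite"
  assumes "\<delta> > 0" "x \<in> level_set \<delta>" "r \<in> sign_vectors"
  shows "norm (f_tilde r x) \<le> CARD('n) / \<delta>"
proof -
  have c: "x \<in> cube" using assms by (auto simp: level_set_def)
  have "\<bar>f_tilde r x $ i\<bar> \<le> 1 * 1 * (1 / \<delta>)" for i
    unfolding f_tilde_eq[OF subsetD[OF level_set_X_bar[OF assms(1)] assms(2)] assms(3)] abs_mult
    using c score_bound[OF assms] assms(1) by (intro mult_mono) (auto simp: cube_def)
  then have "(\<Sum>i\<in>UNIV. \<bar>f_tilde r x $ i\<bar>) \<le> (\<Sum>i\<in>(UNIV :: 'n set). 1 / \<delta>)"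
    by (intro sum_mono) simp
  then show ?thesis using norm_le_l1_cart[of "f_tilde r x"] by simp
qed

lemma noise_bound:
  fixes x :: "real ^ 'n::finite"
  assumes \<pi>: "\<And>i. 0 < \<pi> $ i \<and> \<pi> $ i < 1" and "\<delta> > 0" "x \<in> level_set \<delta>" "r \<in> sign_vectors"
  shows "\<bar>noise \<pi> r x\<bar> \<le> 2 * CARD('n) / \<delta>\<^sup>2"
proof -
  have c: "x \<in> cube" using assms by (auto simp: level_set_def)
  have mean: "\<bar>mean_score \<pi> i x\<bar> \<le> 1 / \<delta>" for i
  proof -
    have "\<bar>mean_score \<pi> i x\<bar> \<le> (\<Sum>s\<in>sign_vectors. \<bar>g_law \<pi> s * score i s x\<bar>)"
      unfolding mean_score_def by (rule sum_abs)
    also have "\<dots> \<le> (\<Sum>s\<in>sign_vectors. g_law \<pi> s * (1 / \<delta>))"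
      using score_bound[OF assms(2,3)] less_imp_le[OF g_law_pos[OF \<pi>]]
      by (intro sum_mono) (auto simp: abs_mult simp del: mult_1_right times_divide_eq_right intro!: mult_left_mono)
    also have "\<dots> = 1 / \<delta>" by (simp only: sum_distrib_right[symmetric] sum_g_law mult_1)
    finally show ?thesis .
  qed
  have "\<bar>x $ i * (1 - x $ i) * score i r x * mean_score \<pi> i x\<bar> \<le> 1 * 1 * (1 / \<delta>) * (1 / \<delta>)" for i
    unfolding abs_mult using c score_bound[OF assms(2-4), of i] mean[of i] assms(2)
    by (intro mult_mono) (auto simp: cube_def)
  then have "\<bar>\<Sum>i\<in>UNIV. x $ i * (1 - x $ i) * score i r x * mean_score \<pi> i x\<bar> \<le> (\<Sum>i\<in>(UNIV::'n set). 1 / \<delta>\<^sup>2)"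
    by (intro order_trans[OF sum_abs] sum_mono) (simp add: power2_eq_square)
  moreover have "\<bar>x $ i * (1 - x $ i) * (mean_score \<pi> i x)\<^sup>2\<bar> \<le> 1 * 1 * ((1 / \<delta>) * (1 / \<delta>))" for i
    unfolding abs_mult power2_eq_square using c mean[of i] assms(2)
    by (intro mult_mono) (auto simp: cube_def)
  then have "\<bar>drift \<pi> x\<bar> \<le> (\<Sum>i\<in>(UNIV::'n set). 1 / \<delta>\<^sup>2)"
    unfolding drift_def by (intro order_trans[OF sum_abs] sum_mono) (simp add: power2_eq_square)
  ultimately show ?thesis unfolding noise_def by simp
qed

text \<open>Averaging over the observation replaces the random score by \<open>mean_score\<close>,
  which turns the first sum in \<open>noise\<close> into the drift.\<close>

lemma noise_mean_zero: "(\<Sum>r\<in>sign_vectors. g_law \<pi> r * noise \<pi> r x) = 0"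
proof -
  have "(\<Sum>r\<in>sign_vectors. g_law \<pi> r * (\<Sum>i\<in>UNIV. x $ i * (1 - x $ i) * score i r x * mean_score \<pi> i x))
     = (\<Sum>r\<in>sign_vectors. \<Sum>i\<in>UNIV. x $ i * (1 - x $ i) * mean_score \<pi> i x * (g_law \<pi> r * score i r x))"
    by (simp add: sum_distrib_left mult_ac)
  also have "\<dots> = (\<Sum>i\<in>UNIV. x $ i * (1 - x $ i) * mean_score \<pi> i x * mean_score \<pi> i x)"
    by (subst sum.swap) (simp only: sum_distrib_left[symmetric] mean_score_def[symmetric])
  also have "\<dots> = drift \<pi> x"
    by (simp add: drift_def power2_eq_square mult.assoc)
  finally show ?thesis
    by (simp only: noise_def right_diff_distrib sum_subtractf sum_distrib_right[symmetric] sum_g_law)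
qed

section \<open>Deterministic convergence criteria\<close>

text \<open>Summability against a non-summable \<open>\<eta>\<close> alone forces only small values
  along a subsequence. The displacement bound \<open>c * \<eta> t\<close> rules out returns to large
  values, as each excursion would use up a fixed part of the series.\<close>

lemma slow_sequence_potential_tendsto_0:
  fixes x :: "nat \<Rightarrow> 'a::metric_space" and \<phi> :: "'a \<Rightarrow> real"
  assumes C: "compact C" "\<And>t. x t \<in> C" and \<phi>: "continuous_on C \<phi>" "\<And>z. z \<in> C \<Longrightarrow> 0 \<le> \<phi> z"
    and \<eta>: "\<And>t. 0 \<le> \<eta> t" "\<not> summable \<eta>" and c: "c > 0" "\<And>t. dist (x (Suc t)) (x t) \<le> c * \<eta> t"
    and s: "summable (\<lambda>t. \<eta> t * \<phi> (x t))"
  shows "(\<lambda>t. \<phi> (x t)) \<longlonglongrightarrow> 0"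
proof (rule LIMSEQ_I)
  fix e0 :: real assume "e0 > 0"
  define e where "e = e0 / 2"
  have e: "e > 0" using \<open>e0 > 0\<close> by (simp add: e_def)
  obtain d where d: "d > 0" "\<And>u v. u \<in> C \<Longrightarrow> v \<in> C \<Longrightarrow> dist v u < d \<Longrightarrow> dist (\<phi> v) (\<phi> u) < e"
    using compact_uniformly_continuous[OF \<phi>(1) C(1)] e unfolding uniformly_continuous_on_def by meson
  have "e * d / c > 0" using e d c by simp
  then obtain N where N: "\<And>m n. m \<ge> N \<Longrightarrow> norm (\<Sum>t=m..<n. \<eta> t * \<phi> (x t)) < e * d / c"
    using s unfolding summable_Cauchy by blast
  have "\<phi> (x m) < e0" if m: "m \<ge> N" for m
  proof (rule ccontr)
    assume "\<not> \<phi> (x m) < e0"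
    then have big: "\<phi> (x m) \<ge> 2 * e" by (simp add: e_def)
    \<comment> \<open>Leaving the region where the potential is large takes a total step size d/c, and spends e d/c of the tail.\<close>
    have "(\<forall>u\<in>{m..<n}. \<phi> (x u) \<ge> e) \<and> (\<Sum>t=m..<n. \<eta> t) < d / c \<and> \<phi> (x n) \<ge> e" if "n \<ge> m" for n
      using that
    proof (induction n rule: dec_induct)
      case base
      then show ?case using big e d c by simp
    next
      case (step n)
      have ge: "\<forall>u\<in>{m..<Suc n}. \<phi> (x u) \<ge> e" using step by (auto simp: less_Suc_eq)
      have "e * (\<Sum>t=m..<Suc n. \<eta> t) \<le> (\<Sum>t=m..<Suc n. \<eta> t * \<phi> (x t))"
        unfolding sum_distrib_left using ge \<eta>(1)
        by (intro sum_mono) (metis mult.commute mult_left_mono)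
      also have "\<dots> < e * d / c" using N[OF m, of "Suc n"] by simp
      also have "e * d / c = e * (d / c)" by simp
      finally have sm: "(\<Sum>t=m..<Suc n. \<eta> t) < d / c" using e by (simp only: mult_less_cancel_left_pos)
      have "dist (x (Suc n)) (x m) \<le> (\<Sum>t=m..<Suc n. c * \<eta> t)"
      proof -
        have "dist (x k) (x m) \<le> (\<Sum>t=m..<k. c * \<eta> t)" if "k \<ge> m" for k
          using that
        proof (induction k rule: dec_induct)
          case (step k)
          have "dist (x (Suc k)) (x m) \<le> dist (x (Suc k)) (x k) + dist (x k) (x m)" by (rule dist_triangle)
          then show ?case using step c(2)[of k] by simp
        qed simp
        from this[of "Suc n"] show ?thesis using step(1) by linarith
      qed
      also have "\<dots> = c * (\<Sum>t=m..<Suc n. \<eta> t)" by (rule sum_distrib_left[symmetric])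
      also have "\<dots> < d" using sm c(1) by (simp only: pos_less_divide_eq mult.commute)
      finally have "dist (\<phi> (x (Suc n))) (\<phi> (x m)) < e" using d(2)[OF C(2) C(2)] by simp
      then have "\<phi> (x (Suc n)) \<ge> e" using big by (simp add: dist_real_def)
      then show ?case using ge sm by blast
    qed
    then have bnd: "(\<Sum>t=m..<n. \<eta> t) < d / c" if "n \<ge> m" for n using that by blast
    \<comment> \<open>The sequence never leaves the region, so the bound on the step sizes holds for
      all \<open>n\<close> and contradicts their divergence.\<close>
    have "summable (\<lambda>t. \<eta> (t + m))"
    proof (rule summableI_nonneg_bounded[where x = "d / c"])
      fix n
      have "(\<Sum>t<n. \<eta> (t + m)) = (\<Sum>t=m..<n + m. \<eta> t)"
        using sum.shift_bounds_nat_ivl[of \<eta> 0 m n] by (simp add: atLeast0LessThan)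
      then show "(\<Sum>t<n. \<eta> (t + m)) \<le> d / c" using bnd[of "n + m"] by simp
    qed (use \<eta> in auto)
    then show False using \<eta>(2) by (simp add: summable_iff_shift)
  qed
  then show "\<exists>N. \<forall>t\<ge>N. norm (\<phi> (x t) - 0) < e0" using \<phi>(2) C(2) by auto
qed

text \<open>On the compact set of points at distance at least \<open>e\<close> from \<open>E\<close>
  the potential has a positive minimum, which \<open>\<phi> (x t)\<close> finally undercuts.\<close>

lemma infdist_tendsto_0_zero_set:
  fixes x :: "nat \<Rightarrow> 'a::metric_space" and \<phi> :: "'a \<Rightarrow> real"
  assumes C: "compact C" "\<And>t. x t \<in> C" and \<phi>: "continuous_on C \<phi>" "\<And>z. z \<in> C \<Longrightarrow> 0 \<le> \<phi> z"
    and E: "\<And>z. z \<in> C \<Longrightarrow> \<phi> z = 0 \<Longrightarrow> z \<in> E" and lim: "(\<lambda>t. \<phi> (x t)) \<longlonglongrightarrow> 0"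
  shows "(\<lambda>t. infdist (x t) E) \<longlonglongrightarrow> 0"
proof (rule LIMSEQ_I)
  fix e :: real assume e: "e > 0"
  define D where "D = C \<inter> {z. e \<le> infdist z E}"
  have "compact D" unfolding D_def
    by (intro compact_Int_closed C closed_Collect_le continuous_intros)
  have "\<exists>m>0. \<forall>z\<in>D. m \<le> \<phi> z"
  proof (cases "D = {}")
    case False
    have "continuous_on D \<phi>" using \<phi>(1) by (rule continuous_on_subset) (simp add: D_def)
    then obtain z where z: "z \<in> D" "\<forall>w\<in>D. \<phi> z \<le> \<phi> w"
      using continuous_attains_inf[OF \<open>compact D\<close> False] by blast
    have "\<phi> z \<noteq> 0" using E[of z] z(1) e by (auto simp: D_def)
    moreover have "\<phi> z \<ge> 0" using \<phi>(2) z(1) by (simp add: D_def)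
    ultimately show ?thesis using z(2) by (intro exI[of _ "\<phi> z"]) auto
  qed (auto intro: exI[of _ 1])
  then obtain m where m: "m > 0" "\<And>z. z \<in> D \<Longrightarrow> m \<le> \<phi> z" by blast
  obtain N where N: "\<And>t. t \<ge> N \<Longrightarrow> \<bar>\<phi> (x t)\<bar> < m" using LIMSEQ_D[OF lim m(1)] by auto
  have "infdist (x t) E < e" if "t \<ge> N" for t
    using N[OF that] m(2)[of "x t"] C(2)[of t] by (force simp: D_def)
  then show "\<exists>N. \<forall>t\<ge>N. norm (infdist (x t) E - 0) < e" by (auto simp: infdist_nonneg)
qed


section \<open>A single sample path with resets\<close>

text \<open>The observations \<open>r\<close> form one fixed path; randomness survives only in
  \<open>signs\<close> and \<open>noise_convergent\<close>, which hold almost surely. The thresholds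
  \<open>1 / real (Suc k)\<close> are countably many, so one null set covers all level sets.\<close>

locale resetting_run =
  fixes \<pi> :: "real ^ 'n::finite" and \<eta> :: "nat \<Rightarrow> real" and K :: "nat \<Rightarrow> (real ^ 'n) set"
    and P\<^sub>0 P_init :: "real ^ 'n" and r :: "nat \<Rightarrow> int ^ 'n"
  assumes \<pi>: "\<And>i. 0 < \<pi> $ i \<and> \<pi> $ i < 1"
    and eta_pos: "\<And>t. \<eta> t > 0"
    and eta_not_summable: "\<not> summable \<eta>"
    and eta_sq_summable: "summable (\<lambda>t. (\<eta> t)\<^sup>2)"
    and K: "truncation_sets K" "exhausts_compacts K"
    and start: "P\<^sub>0 \<in> K 0" "P_init \<in> K 0"
    and signs: "\<And>t. t \<ge> 1 \<Longrightarrow> r t \<in> sign_vectors"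
    and noise_convergent: "\<And>k::nat. convergent (\<lambda>T. \<Sum>t<T.
      if P_pr K \<eta> P\<^sub>0 P_init r t \<in> level_set (1 / real (Suc k))
      then \<eta> t * noise \<pi> (r (Suc t)) (P_pr K \<eta> P\<^sub>0 P_init r t) else 0)"
begin

definition X :: "nat \<Rightarrow> real ^ 'n" where "X t = fst (estimator K \<eta> P\<^sub>0 P_init r t)"

definition resets :: "nat \<Rightarrow> nat" where "resets t = snd (estimator K \<eta> P\<^sub>0 P_init r t)"

definition proposal :: "nat \<Rightarrow> real ^ 'n" where
  "proposal t = X t + \<eta> t *\<^sub>R f_tilde (r (Suc t)) (X t)"

definition noise_sum :: "real \<Rightarrow> nat \<Rightarrow> real" where
  "noise_sum \<delta> T = (\<Sum>t<T. if X t \<in> level_set \<delta> then \<eta> t * noise \<pi> (r (Suc t)) (X t) else 0)"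

lemma X_Suc: "X (Suc t) = (if proposal t \<in> K (resets t) then proposal t else P\<^sub>0)"
  and resets_Suc: "resets (Suc t) = (if proposal t \<in> K (resets t) then resets t else resets t + 1)"
  by (simp_all add: X_def resets_def proposal_def Let_def split: prod.split)

lemma K_mono: "s \<le> t \<Longrightarrow> K s \<subseteq> K t"
  by (rule lift_Suc_mono_le[of K]) (use K(1) in \<open>auto simp: truncation_sets_def\<close>)

lemma K_X_bar: "K t \<subseteq> X_bar"
  using K(1) by (auto simp: truncation_sets_def)

lemma X_in_K: "X t \<in> K (resets t)"
proof (induction t)
  case 0
  then show ?case using start by (simp add: X_def resets_def)
next
  case (Suc t)
  then show ?case using start K_mono[of 0 "Suc (resets t)"] by (auto simp: X_Suc resets_Suc)
qed

lemma X_in_X_bar: "X t \<in> X_bar"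
  using X_in_K K_X_bar by blast

lemma noise_sum_convergent: "convergent (noise_sum (1 / real (Suc k)))"
proof -
  have "P_pr K \<eta> P\<^sub>0 P_init r t = X t" for t by (simp add: P_pr_def X_def)
  then show ?thesis using noise_convergent[of k] by (simp add: noise_sum_def[abs_def] cong: if_cong)
qed

lemma eta_eventually_le: assumes "e > 0" shows "eventually (\<lambda>t. \<eta> t \<le> e) sequentially"
proof -
  have "(\<lambda>t. (\<eta> t)\<^sup>2) \<longlonglongrightarrow> 0" by (rule summable_LIMSEQ_zero[OF eta_sq_summable])
  then have "eventually (\<lambda>t. (\<eta> t)\<^sup>2 < e\<^sup>2) sequentially"
    using assms by (intro order_tendstoD(2)[of _ 0]) auto
  then show ?thesis
    by eventually_elim (use assms in \<open>auto intro: less_imp_le power2_less_imp_less\<close>)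
qed

text \<open>\<open>log_lik_step\<close> along the run, for times so late that the step size is below
  its threshold; the noise term is written as an increment of \<open>noise_sum\<close> so that it
  telescopes.\<close>

lemma ascent_step:
  assumes "\<delta> > 0"
  obtains C T where "C \<ge> 0"
    "\<And>t. t \<ge> T \<Longrightarrow> X t \<in> level_set \<delta> \<Longrightarrow> proposal t \<in> level_set (\<delta> / 2) \<and>
      log_lik \<pi> (proposal t) \<ge> log_lik \<pi> (X t) + \<eta> t * drift \<pi> (X t)
        + (noise_sum \<delta> (Suc t) - noise_sum \<delta> t) - C * (\<eta> t)\<^sup>2"
proof -
  obtain C e where C: "C \<ge> 0" "e > 0" and step: "\<And>x r \<eta>. x \<in> level_set \<delta> \<Longrightarrow> r \<in> sign_vectors \<Longrightarrow> 0 < \<eta> \<Longrightarrow> \<eta> \<le> e \<Longrightarrow>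
      x + \<eta> *\<^sub>R f_tilde r x \<in> level_set (\<delta> / 2) \<and>
      log_lik \<pi> (x + \<eta> *\<^sub>R f_tilde r x) \<ge> log_lik \<pi> x + \<eta> * (drift \<pi> x + noise \<pi> r x) - C * \<eta>\<^sup>2"
    using log_lik_step[OF \<pi> assms] by metis
  obtain T where T: "\<And>t. t \<ge> T \<Longrightarrow> \<eta> t \<le> e"
    using eta_eventually_le[OF C(2)] by (auto simp: eventually_sequentially)
  show thesis
  proof (rule that[OF C(1)])
    fix t assume t: "t \<ge> T" and X: "X t \<in> level_set \<delta>"
    show "proposal t \<in> level_set (\<delta> / 2) \<and>
      log_lik \<pi> (proposal t) \<ge> log_lik \<pi> (X t) + \<eta> t * drift \<pi> (X t)
        + (noise_sum \<delta> (Suc t) - noise_sum \<delta> t) - C * (\<eta> t)\<^sup>2"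
      using step[OF X signs[of "Suc t"] eta_pos T[OF t]] X
      by (simp add: proposal_def noise_sum_def distrib_left)
  qed
qed

text \<open>
  After a late reset the log-likelihood stays above its value at the restart point minus 1,
  hence the run stays in a compact set contained in the current truncation set.
\<close>

lemma resets_bounded: "\<exists>T. \<forall>t\<ge>T. resets t = resets T"
proof (rule ccontr)
  assume contra: "\<nexists>T. \<forall>t\<ge>T. resets t = resets T"
  have mono: "resets s \<le> resets t" if "s \<le> t" for s t
    by (rule lift_Suc_mono_le[OF _ that]) (auto simp: resets_Suc)
  have unbounded: "\<exists>t\<ge>T. resets t \<ge> m" for m T
  proof (induction m)
    case (Suc m)
    then obtain t where "t \<ge> T" "resets t \<ge> m" by blast
    moreover obtain u where "u \<ge> t" "resets u \<noteq> resets t" using contra by blast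
    ultimately show ?case using mono[of t u] by (intro exI[of _ u]) auto
  qed auto
  \<comment> \<open>The unit subtracted here is the room left after a restart for noise and
    second-order errors.\<close>
  obtain \<delta>' where \<delta>': "\<delta>' > 0" "\<And>x. x \<in> X_bar \<Longrightarrow> log_lik \<pi> P\<^sub>0 - 1 \<le> log_lik \<pi> x \<Longrightarrow> x \<in> level_set \<delta>'"
    using log_lik_superlevel[OF \<pi>] by metis
  obtain k where k: "1 / real (Suc k) < \<delta>'" using \<delta>'(1) nat_approx_posE by blast
  define \<delta> where "\<delta> = 1 / real (Suc k)"
  have \<delta>: "\<delta> > 0" by (simp add: \<delta>_def)
  have lev: "x \<in> level_set \<delta>" if "x \<in> X_bar" "log_lik \<pi> P\<^sub>0 - 1 \<le> log_lik \<pi> x" for x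
    using \<delta>'(2)[OF that] level_set_mono[of \<delta> \<delta>'] k by (auto simp: \<delta>_def)
  \<comment> \<open>A truncation set that contains every late proposal made from
    \<open>level_set \<delta>\<close>; a step may halve \<open>mix\<close>, hence
    \<open>\<delta> / 2\<close>. Here \<open>exhausts_compacts\<close> enters.\<close>
  obtain \<tau> where \<tau>: "level_set (\<delta> / 2) \<subseteq> K \<tau>"
  proof -
    have "compact (level_set (\<delta> / 2) :: (real ^ 'n) set) \<and> level_set (\<delta> / 2) \<subseteq> (X_bar :: (real ^ 'n) set)"
      using \<delta> by (intro conjI compact_level_set level_set_X_bar) simp
    then show thesis using K(2) that unfolding exhausts_compacts_def by metis
  qed
  obtain C T1 where C: "C \<ge> 0" and asc: "\<And>t. t \<ge> T1 \<Longrightarrow> X t \<in> level_set \<delta> \<Longrightarrow> proposal t \<in> level_set (\<delta> / 2) \<and>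
      log_lik \<pi> (proposal t) \<ge> log_lik \<pi> (X t) + \<eta> t * drift \<pi> (X t)
        + (noise_sum \<delta> (Suc t) - noise_sum \<delta> t) - C * (\<eta> t)\<^sup>2"
    using ascent_step[OF \<delta>] by metis
  \<comment> \<open>Noise and second-order errors each receive half of the unit.\<close>
  have "Cauchy (noise_sum \<delta>)" using noise_sum_convergent by (simp add: \<delta>_def Cauchy_convergent_iff)
  from CauchyD[OF this, of "1/2"]
  obtain T2 where T2: "\<And>m n. m \<ge> T2 \<Longrightarrow> n \<ge> T2 \<Longrightarrow> norm (noise_sum \<delta> m - noise_sum \<delta> n) < 1/2"
    by auto
  have "summable (\<lambda>t. C * (\<eta> t)\<^sup>2)" by (intro summable_mult eta_sq_summable)
  then have "\<exists>N. \<forall>m\<ge>N. \<forall>n. norm (\<Sum>t=m..<n. C * (\<eta> t)\<^sup>2) < 1/2"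
    unfolding summable_Cauchy by (rule allE[of _ "1/2"]) simp
  then obtain T3 where T3: "\<And>m n. m \<ge> T3 \<Longrightarrow> norm (\<Sum>t=m..<n. C * (\<eta> t)\<^sup>2) < 1/2"
    by blast
  obtain T4 where T4: "T4 \<ge> max T1 (max T2 T3)" "resets T4 \<ge> \<tau>"
    using unbounded[where T = "max T1 (max T2 T3)" and m = \<tau>] by blast
  obtain u where u: "u \<ge> T4" "resets u \<noteq> resets T4" using contra by blast
  \<comment> \<open>As the number of resets never settles, one more happens after \<open>T4\<close>;
    the run is at \<open>P\<^sub>0\<close> at the following time \<open>s\<close>.\<close>
  have "\<exists>t\<ge>T4. proposal t \<notin> K (resets t)"
  proof (rule ccontr)
    assume no: "\<not> (\<exists>t\<ge>T4. proposal t \<notin> K (resets t))"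
    have "resets t = resets T4" if "t \<ge> T4" for t
      using that by (induction t rule: dec_induct) (use no in \<open>auto simp: resets_Suc\<close>)
    then show False using u by blast
  qed
  then obtain s' where s': "s' \<ge> T4" "proposal s' \<notin> K (resets s')" by blast
  define s where "s = Suc s'"
  have s: "s \<ge> T1" "s \<ge> T2" "s \<ge> T3" "X s = P\<^sub>0" "resets s \<ge> \<tau>"
    using s' T4 mono[of T4 s'] by (auto simp: s_def X_Suc resets_Suc)
  \<comment> \<open>The two claims carry each other: the lower bound keeps \<open>X t\<close> in
    \<open>level_set \<delta>\<close>, so the proposal lies in the current truncation set and is
    accepted, and the ascent inequality continues the bound.\<close>
  have stay: "resets t = resets s \<and>
      log_lik \<pi> (X t) \<ge> log_lik \<pi> P\<^sub>0 + (noise_sum \<delta> t - noise_sum \<delta> s) - (\<Sum>u=s..<t. C * (\<eta> u)\<^sup>2)" if "t \<ge> s" for t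
    using that
  proof (induction t rule: dec_induct)
    case base
    then show ?case using s by simp
  next
    case (step t)
    have "log_lik \<pi> (X t) \<ge> log_lik \<pi> P\<^sub>0 - 1"
    proof -
      have "\<bar>noise_sum \<delta> t - noise_sum \<delta> s\<bar> < 1/2" "\<bar>\<Sum>u=s..<t. C * (\<eta> u)\<^sup>2\<bar> < 1/2"
        using step(1) T2[of t s] T3[of s t] s by auto
      then show ?thesis using step unfolding abs_less_iff by linarith
    qed
    then have X: "X t \<in> level_set \<delta>" using lev X_in_X_bar by blast
    note a = asc[OF _ X]
    have "proposal t \<in> K (resets t)"
      using a step s \<tau> K_mono[of \<tau> "resets t"] by auto
    then have "resets (Suc t) = resets s" and XS: "X (Suc t) = proposal t"
      using step by (auto simp: resets_Suc X_Suc)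
    moreover have "0 \<le> \<eta> t * drift \<pi> (X t)"
      using eta_pos[of t] drift_nonneg[OF X_bar_cube[OF X_in_X_bar]] by (simp add: less_imp_le)
    ultimately show ?case using a step s by (auto simp: XS)
  qed
  then show False using contra by metis
qed

theorem run_converges: "(\<lambda>t. infdist (X t) (E_bar \<pi>)) \<longlonglongrightarrow> 0"
proof -
  obtain T0 where T0: "\<And>t. t \<ge> T0 \<Longrightarrow> resets t = resets T0" using resets_bounded by blast
  have XK: "X t \<in> K (resets T0)" if "t \<ge> T0" for t using X_in_K[of t] T0[OF that] by simp
  have no_reset: "X (Suc t) = proposal t" if "t \<ge> T0" for t
    using T0[OF that] T0[of "Suc t"] that by (auto simp: resets_Suc X_Suc split: if_splits)
  \<comment> \<open>After the last reset one compact truncation set contains the run, so a single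
    level set serves for all later times.\<close>
  obtain \<delta>' where \<delta>': "\<delta>' > 0" "K (resets T0) \<subseteq> level_set \<delta>'"
    using compact_subset_level_set[of "K (resets T0)"] K(1) K_X_bar unfolding truncation_sets_def by metis
  obtain k where k: "1 / real (Suc k) < \<delta>'" using \<delta>'(1) nat_approx_posE by blast
  define \<delta> where "\<delta> = 1 / real (Suc k)"
  have \<delta>: "\<delta> > 0" by (simp add: \<delta>_def)
  have lev: "X t \<in> level_set \<delta>" if "t \<ge> T0" for t
    using XK[OF that] \<delta>'(2) level_set_mono[of \<delta> \<delta>'] k by (auto simp: \<delta>_def)
  obtain C T1 where C: "C \<ge> 0" and asc: "\<And>t. t \<ge> T1 \<Longrightarrow> X t \<in> level_set \<delta> \<Longrightarrow> proposal t \<in> level_set (\<delta> / 2) \<and>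
      log_lik \<pi> (proposal t) \<ge> log_lik \<pi> (X t) + \<eta> t * drift \<pi> (X t)
        + (noise_sum \<delta> (Suc t) - noise_sum \<delta> t) - C * (\<eta> t)\<^sup>2"
    using ascent_step[OF \<delta>] by metis
  define T where "T = max T0 T1"
  define x where "x t = X (t + T)" for t
  define h where "h t = \<eta> (t + T)" for t
  have h: "0 < h t" for t by (simp add: h_def eta_pos)
  have xlev: "x t \<in> level_set \<delta>" for t using lev by (simp add: x_def T_def)
  have x_Suc: "x (Suc t) = x t + h t *\<^sub>R f_tilde (r (Suc (t + T))) (x t)" for t
    using no_reset[of "t + T"] by (simp add: x_def h_def T_def proposal_def)
  have drift0: "0 \<le> drift \<pi> z" if "z \<in> level_set \<delta>" for z
    using that by (auto simp: level_set_def drift_nonneg)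
  \<comment> \<open>Telescoping the ascent inequality: the log-likelihood is at most 0, the noise
    sums are bounded and the squared step sizes are summable, which bounds the accumulated
    drift.\<close>
  have "summable (\<lambda>t. h t * drift \<pi> (x t))"
  proof -
    have sq: "summable (\<lambda>t. (h t)\<^sup>2)"
      unfolding h_def using eta_sq_summable by (subst summable_iff_shift[of "\<lambda>t. (\<eta> t)\<^sup>2"])
    have step: "h t * drift \<pi> (x t) \<le> (log_lik \<pi> (x (Suc t)) - log_lik \<pi> (x t))
        - (noise_sum \<delta> (Suc t + T) - noise_sum \<delta> (t + T)) + C * (h t)\<^sup>2" for t
      using asc[of "t + T"] no_reset[of "t + T"] lev[of "t + T"] max.cobounded1[of T0 T1] max.cobounded2[of T1 T0]
      by (simp add: x_def h_def T_def trans_le_add2 algebra_simps)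
    obtain B where B: "\<And>t. norm (noise_sum \<delta> t) \<le> B"
      using noise_sum_convergent[of k] convergent_imp_Bseq BseqE unfolding \<delta>_def by metis
    show ?thesis
    proof (rule summableI_nonneg_bounded)
      show "0 \<le> h t * drift \<pi> (x t)" for t using h[of t] drift0[OF xlev] by (simp add: less_imp_le)
      fix n
      have "(\<Sum>t<n. h t * drift \<pi> (x t)) \<le> (\<Sum>t<n. (log_lik \<pi> (x (Suc t)) - log_lik \<pi> (x t))
        - (noise_sum \<delta> (Suc t + T) - noise_sum \<delta> (t + T)) + C * (h t)\<^sup>2)"
        by (intro sum_mono step)
      also have "\<dots> = (log_lik \<pi> (x n) - log_lik \<pi> (x 0)) - (noise_sum \<delta> (n + T) - noise_sum \<delta> T) + C * (\<Sum>t<n. (h t)\<^sup>2)"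
        using sum_lessThan_telescope[of "\<lambda>t. log_lik \<pi> (x t)" n] sum_lessThan_telescope[of "\<lambda>t. noise_sum \<delta> (t + T)" n]
        by (simp add: sum.distrib sum_subtractf sum_distrib_left)
      also have "\<dots> \<le> - log_lik \<pi> (x 0) + 2 * B + C * (\<Sum>t. (h t)\<^sup>2)"
      proof -
        have "log_lik \<pi> (x n) \<le> 0" using log_lik_nonpos[OF \<pi>] X_in_X_bar by (simp add: x_def)
        moreover have "C * (\<Sum>t<n. (h t)\<^sup>2) \<le> C * (\<Sum>t. (h t)\<^sup>2)"
          using C sq by (intro mult_left_mono sum_le_suminf) auto
        ultimately show ?thesis using B[of "n + T"] B[of T] by (simp add: abs_le_iff)
      qed
      finally show "(\<Sum>t<n. h t * drift \<pi> (x t)) \<le> - log_lik \<pi> (x 0) + 2 * B + C * (\<Sum>t. (h t)\<^sup>2)" .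
    qed
  qed
  moreover have "dist (x (Suc t)) (x t) \<le> CARD('n) / \<delta> * h t" for t
    using norm_f_tilde_le[OF \<delta> xlev[of t] signs[of "Suc (t + T)"]] h[of t]
      mult_right_mono[of "norm (f_tilde (r (Suc (t + T))) (x t))" "CARD('n) / \<delta>" "h t"]
    by (simp add: x_Suc dist_norm mult.commute)
  moreover have "\<not> summable h"
    unfolding h_def using eta_not_summable by (subst summable_iff_shift)
  ultimately have "(\<lambda>t. drift \<pi> (x t)) \<longlonglongrightarrow> 0"
    using h \<delta> by (intro slow_sequence_potential_tendsto_0[of "level_set \<delta>" x "drift \<pi>" h "CARD('n) / \<delta>"]
        compact_level_set continuous_on_drift xlev drift0) (auto simp: less_imp_le)
  then have "(\<lambda>t. infdist (x t) (E_bar \<pi>)) \<longlonglongrightarrow> 0"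
    using level_set_X_bar[OF \<delta>]
    by (intro infdist_tendsto_0_zero_set[of "level_set \<delta>" x "drift \<pi>"]
        compact_level_set continuous_on_drift xlev drift0 \<delta> drift_zero_imp_E_bar) auto
  then show ?thesis unfolding x_def by (rule LIMSEQ_offset)
qed

end


section \<open>Convergence of martingale difference sums\<close>

text \<open>Stands for measurability with respect to the history up to time \<open>t\<close>, stated
  on paths. Entry 0 is left out because observations start at time 1.\<close>

definition adapted :: "nat \<Rightarrow> ((nat \<Rightarrow> 'b) \<Rightarrow> 'c) \<Rightarrow> bool" where
  "adapted t F \<longleftrightarrow> (\<forall>\<rho> \<rho>'. (\<forall>u\<in>{1..t}. \<rho> u = \<rho>' u) \<longrightarrow> F \<rho> = F \<rho>')"

lemma adaptedD: "adapted t F \<Longrightarrow> (\<And>u. u \<in> {1..t} \<Longrightarrow> \<rho> u = \<rho>' u) \<Longrightarrow> F \<rho> = F \<rho>'"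
  by (auto simp: adapted_def)

lemma adapted_mono: "adapted s F \<Longrightarrow> s \<le> t \<Longrightarrow> adapted t F"
  unfolding adapted_def by force

locale iid_sequence = prob_space M for M :: "'a measure" +
  fixes Y :: "nat \<Rightarrow> 'a \<Rightarrow> 'b::countable" and V :: "'b set" and g :: "'b \<Rightarrow> real"
  assumes indep: "indep_vars (\<lambda>_. count_space UNIV) Y {1..}"
    and finite_V: "finite V"
    and law: "\<And>t v. t \<ge> 1 \<Longrightarrow> v \<in> V \<Longrightarrow> prob {\<omega> \<in> space M. Y t \<omega> = v} = g v"
    and mass: "(\<Sum>v\<in>V. g v) = 1"
begin

abbreviation path :: "'a \<Rightarrow> nat \<Rightarrow> 'b" where "path \<omega> \<equiv> (\<lambda>t. Y t \<omega>)"

lemma Y_measurable [measurable]: "t \<ge> 1 \<Longrightarrow> Y t \<in> measurable M (count_space UNIV)"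
  using indep by (simp add: indep_vars_def)

lemma Y_event: "t \<ge> 1 \<Longrightarrow> {\<omega> \<in> space M. Y t \<omega> \<in> A} \<in> events"
  using measurable_sets[OF Y_measurable, of t A] by (simp add: vimage_def Int_def conj_commute)

lemma AE_Y_in_V:
  assumes "t \<ge> 1" shows "AE \<omega> in M. Y t \<omega> \<in> V"
proof -
  have "prob {\<omega> \<in> space M. Y t \<omega> \<in> V} = prob (\<Union>v\<in>V. {\<omega> \<in> space M. Y t \<omega> = v})"
    by (rule arg_cong[where f = prob]) auto
  also have "\<dots> = (\<Sum>v\<in>V. prob {\<omega> \<in> space M. Y t \<omega> = v})"
    using Y_event[OF assms, of "{_}"] finite_V
    by (intro finite_measure_finite_Union) (auto simp: disjoint_family_on_def)
  also have "\<dots> = 1" using law[OF assms] mass by simp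
  finally show ?thesis using prob_eq_1[OF Y_event[OF assms]] by simp
qed

lemma adapted_factor:
  assumes "adapted t F"
  shows "(\<lambda>\<omega>. F (path \<omega>)) = F \<circ> (\<lambda>\<omega>. restrict (path \<omega>) {1..t})"
  unfolding comp_def by (intro ext adaptedD[OF assms]) simp

text \<open>A finite product of countable discrete spaces is discrete, so every function on it is
  measurable.\<close>

lemma measurable_on_PiM:
  assumes "finite A"
  shows "(F :: (nat \<Rightarrow> 'b) \<Rightarrow> real) \<in> borel_measurable (PiM A (\<lambda>_. count_space UNIV))"
  using count_space_PiM_finite[OF assms, of "\<lambda>_. UNIV :: 'b set"] by simp

lemma adapted_measurable:
  fixes F :: "(nat \<Rightarrow> 'b) \<Rightarrow> real"
  assumes "adapted t F"
  shows "(\<lambda>\<omega>. F (path \<omega>)) \<in> borel_measurable M"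
proof -
  have "(\<lambda>\<omega>. restrict (path \<omega>) {1..t}) \<in> measurable M (PiM {1..t} (\<lambda>_. count_space UNIV))"
    by (intro measurable_restrict Y_measurable) auto
  then have "F \<circ> (\<lambda>\<omega>. restrict (path \<omega>) {1..t}) \<in> borel_measurable M"
    by (rule measurable_comp[OF _ measurable_on_PiM]) simp
  then show ?thesis unfolding adapted_factor[OF assms] .
qed

lemma adapted_integrable:
  fixes F :: "(nat \<Rightarrow> 'b) \<Rightarrow> real"
  assumes "adapted t F" "\<And>\<rho>. \<bar>F \<rho>\<bar> \<le> B"
  shows "integrable M (\<lambda>\<omega>. F (path \<omega>))"
  using assms by (intro integrable_const_bound[of _ B] adapted_measurable) auto

text \<open>The history up to \<open>t\<close> and the value at \<open>Suc t\<close> are built from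
  disjoint blocks of an independent family, so the expectation factors.\<close>

lemma expectation_adapted_times_indicator:
  fixes F :: "(nat \<Rightarrow> 'b) \<Rightarrow> real"
  assumes F: "adapted t F" "\<And>\<rho>. \<bar>F \<rho>\<bar> \<le> B" and v: "v \<in> V"
  shows "expectation (\<lambda>\<omega>. F (path \<omega>) * of_bool (Y (Suc t) \<omega> = v)) = g v * expectation (\<lambda>\<omega>. F (path \<omega>))"
proof -
  have "indep_var (PiM {1..t} (\<lambda>_. count_space UNIV)) (\<lambda>\<omega>. restrict (path \<omega>) {1..t})
      (PiM {Suc t} (\<lambda>_. count_space UNIV)) (\<lambda>\<omega>. restrict (path \<omega>) {Suc t})"
    using indep_var_restrict[OF indep, of "{1..t}" "{Suc t}"] by simp
  from indep_var_compose[OF this measurable_on_PiM[of _ F] measurable_on_PiM[of _ "\<lambda>\<rho>. of_bool (\<rho> (Suc t) = v)"]]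
  have "indep_var borel (F \<circ> (\<lambda>\<omega>. restrict (path \<omega>) {1..t}))
      borel ((\<lambda>\<rho>. of_bool (\<rho> (Suc t) = v)) \<circ> (\<lambda>\<omega>. restrict (path \<omega>) {Suc t}))"
    by simp
  then have "indep_var borel (\<lambda>\<omega>. F (path \<omega>)) borel (\<lambda>\<omega>. of_bool (Y (Suc t) \<omega> = v))"
    unfolding adapted_factor[OF F(1), symmetric] by (simp add: comp_def)
  moreover have "integrable M (\<lambda>\<omega>. of_bool (Y (Suc t) \<omega> = v) :: real)"
    by (rule adapted_integrable[of "Suc t" "\<lambda>\<rho>. of_bool (\<rho> (Suc t) = v)" 1]) (auto simp: adapted_def)
  ultimately have "expectation (\<lambda>\<omega>. F (path \<omega>) * of_bool (Y (Suc t) \<omega> = v))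
      = expectation (\<lambda>\<omega>. F (path \<omega>)) * expectation (\<lambda>\<omega>. of_bool (Y (Suc t) \<omega> = v))"
    using adapted_integrable[OF F] by (intro indep_var_lebesgue_integral)
  also have "expectation (\<lambda>\<omega>. of_bool (Y (Suc t) \<omega> = v)) = expectation (indicator {\<omega> \<in> space M. Y (Suc t) \<omega> = v})"
    by (intro Bochner_Integration.integral_cong) (auto simp: indicator_def)
  also have "\<dots> = g v" using law[OF _ v, of "Suc t"] Y_event[of "Suc t" "{v}"] by simp
  finally show ?thesis by simp
qed

text \<open>\<open>c \<rho> v\<close> is the increment after history \<open>\<rho>\<close> when the
  next value is \<open>v\<close>. With finitely many relevant values, the conditional mean given the
  history is a finite sum, which takes the place of conditional expectation.\<close>

definition martingale_difference :: "nat \<Rightarrow> ((nat \<Rightarrow> 'b) \<Rightarrow> 'b \<Rightarrow> real) \<Rightarrow> real \<Rightarrow> bool" where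
  "martingale_difference t c B \<longleftrightarrow>
     adapted t c \<and> (\<forall>\<rho>. (\<Sum>v\<in>V. g v * c \<rho> v) = 0) \<and> (\<forall>\<rho> v. \<bar>c \<rho> v\<bar> \<le> B)"

lemma martingale_difference_adapted:
  assumes "martingale_difference t c B"
  shows "adapted (Suc t) (\<lambda>\<rho>. c \<rho> (\<rho> (Suc t)))"
  unfolding adapted_def
proof (intro allI impI)
  fix \<rho> \<rho>' :: "nat \<Rightarrow> 'b" assume eq: "\<forall>u\<in>{1..Suc t}. \<rho> u = \<rho>' u"
  have "c \<rho> = c \<rho>'" using assms eq by (intro adaptedD[of t c]) (auto simp: martingale_difference_def)
  then show "c \<rho> (\<rho> (Suc t)) = c \<rho>' (\<rho>' (Suc t))" using eq by simp
qed

text \<open>Splitting by the next value reduces conditioning to independence of the next value from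
  the history.\<close>

lemma expectation_martingale_difference:
  assumes c: "martingale_difference t c B"
  shows "expectation (\<lambda>\<omega>. c (path \<omega>) (Y (Suc t) \<omega>)) = 0"
proof -
  have ad: "adapted t (\<lambda>\<rho>. c \<rho> v)" for v using c unfolding martingale_difference_def adapted_def by metis
  have bd: "\<bar>c \<rho> v\<bar> \<le> B" for \<rho> v using c by (simp add: martingale_difference_def)
  have ad': "adapted (Suc t) (\<lambda>\<rho>. c \<rho> v * of_bool (\<rho> (Suc t) = v))" for v
    using ad[of v] unfolding adapted_def by (metis atLeastAtMostSuc_conv insertCI le_add1 plus_1_eq_Suc)
  have int: "integrable M (\<lambda>\<omega>. c (path \<omega>) v * of_bool (Y (Suc t) \<omega> = v))" for v
  proof (rule adapted_integrable[OF ad', of v B])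
    show "\<bar>c \<rho> v * of_bool (\<rho> (Suc t) = v)\<bar> \<le> B" for \<rho>
      using bd[of \<rho> v] by (auto intro: order_trans[OF abs_ge_zero])
  qed
  have meas: "(\<lambda>\<omega>. c (path \<omega>) (Y (Suc t) \<omega>)) \<in> borel_measurable M"
    using adapted_measurable[OF martingale_difference_adapted[OF c]] .
  have "expectation (\<lambda>\<omega>. c (path \<omega>) (Y (Suc t) \<omega>))
      = expectation (\<lambda>\<omega>. \<Sum>v\<in>V. c (path \<omega>) v * of_bool (Y (Suc t) \<omega> = v))"
  proof (rule integral_cong_AE)
    show "AE \<omega> in M. c (path \<omega>) (Y (Suc t) \<omega>) = (\<Sum>v\<in>V. c (path \<omega>) v * of_bool (Y (Suc t) \<omega> = v))"
      using AE_Y_in_V[of "Suc t", OF le_add1[of 1 t, unfolded plus_1_eq_Suc]]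
    proof eventually_elim
      case (elim \<omega>)
      then show ?case using finite_V by (simp add: of_bool_def sum.delta' if_distrib cong: if_cong)
    qed
  qed (use meas int in auto)
  also have "\<dots> = (\<Sum>v\<in>V. expectation (\<lambda>\<omega>. c (path \<omega>) v * of_bool (Y (Suc t) \<omega> = v)))"
    by (rule Bochner_Integration.integral_sum) (rule int)
  also have "\<dots> = (\<Sum>v\<in>V. g v * expectation (\<lambda>\<omega>. c (path \<omega>) v))"
    by (intro sum.cong refl expectation_adapted_times_indicator[OF ad bd])
  also have "\<dots> = expectation (\<lambda>\<omega>. \<Sum>v\<in>V. g v * c (path \<omega>) v)"
    using adapted_integrable[OF ad bd] by (subst Bochner_Integration.integral_sum) auto
  also have "\<dots> = 0" using c by (simp add: martingale_difference_def)
  finally show ?thesis .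
qed

definition partial_sum :: "(nat \<Rightarrow> (nat \<Rightarrow> 'b) \<Rightarrow> 'b \<Rightarrow> real) \<Rightarrow> nat \<Rightarrow> nat \<Rightarrow> (nat \<Rightarrow> 'b) \<Rightarrow> real" where
  "partial_sum c m T \<rho> = (\<Sum>t=m..<T. c t \<rho> (\<rho> (Suc t)))"

lemma partial_sum_adapted:
  assumes "\<And>t. martingale_difference t (c t) (b t)"
  shows "adapted T (partial_sum c m T)"
  unfolding adapted_def partial_sum_def
proof (intro allI impI sum.cong refl)
  fix \<rho> \<rho>' :: "nat \<Rightarrow> 'b" and t assume eq: "\<forall>u\<in>{1..T}. \<rho> u = \<rho>' u" and t: "t \<in> {m..<T}"
  show "c t \<rho> (\<rho> (Suc t)) = c t \<rho>' (\<rho>' (Suc t))"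
    using adaptedD[OF martingale_difference_adapted[OF assms[of t]], of \<rho> \<rho>'] eq t by auto
qed

lemma partial_sum_bound:
  assumes "\<And>t. martingale_difference t (c t) (b t)"
  shows "\<bar>partial_sum c m T \<rho>\<bar> \<le> (\<Sum>t=m..<T. b t)"
  unfolding partial_sum_def using assms
  by (intro order_trans[OF sum_abs] sum_mono) (simp add: martingale_difference_def)

text \<open>Orthogonality of increments: the mean square grows at each time by the mean square of
  the new increment only.\<close>

lemma second_moment_partial_sum:
  assumes c: "\<And>t. martingale_difference t (c t) (b t)" and "m \<le> T"
  shows "expectation (\<lambda>\<omega>. (partial_sum c m T (path \<omega>))\<^sup>2) \<le> (\<Sum>t=m..<T. (b t)\<^sup>2)"
  using \<open>m \<le> T\<close>
proof (induction T rule: dec_induct)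
  case base
  then show ?case by (simp add: partial_sum_def)
next
  case (step T)
  define A where "A \<omega> = partial_sum c m T (path \<omega>)" for \<omega>
  define D where "D \<omega> = c T (path \<omega>) (Y (Suc T) \<omega>)" for \<omega>
  define BA where "BA = (\<Sum>t=m..<T. b t)"
  have b0: "0 \<le> b t" for t using c[of t] abs_ge_zero order_trans unfolding martingale_difference_def by blast
  have Am: "A \<in> borel_measurable M" and Dm: "D \<in> borel_measurable M"
    unfolding A_def[abs_def] D_def[abs_def]
    using adapted_measurable[OF partial_sum_adapted[OF c]]
      adapted_measurable[OF martingale_difference_adapted[OF c[of T]]] by auto
  have Ab: "\<bar>A \<omega>\<bar> \<le> BA" for \<omega> unfolding A_def BA_def by (rule partial_sum_bound[OF c])
  have Db: "\<bar>D \<omega>\<bar> \<le> b T" for \<omega> using c[of T] by (simp add: D_def martingale_difference_def)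
  have BA0: "0 \<le> BA" by (simp add: BA_def b0 sum_nonneg)
  have iA: "integrable M (\<lambda>\<omega>. (A \<omega>)\<^sup>2)"
    using Am Ab BA0 by (intro integrable_const_bound[of _ "BA\<^sup>2"]) (auto intro!: power_mono simp: abs_le_square_iff[symmetric])
  have iD: "integrable M (\<lambda>\<omega>. (D \<omega>)\<^sup>2)"
    using Dm Db b0 by (intro integrable_const_bound[of _ "(b T)\<^sup>2"]) (auto simp: abs_le_square_iff[symmetric])
  have iAD: "integrable M (\<lambda>\<omega>. A \<omega> * D \<omega>)"
    using Am Dm Ab Db BA0 by (intro integrable_const_bound[of _ "BA * b T"]) (auto simp: abs_mult intro!: mult_mono)
  \<comment> \<open>The partial sum is determined by the history, so its product with the next
    increment is again a martingale difference, and the cross term has mean 0.\<close>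
  have md: "martingale_difference T (\<lambda>\<rho> v. partial_sum c m T \<rho> * c T \<rho> v) (BA * b T)"
    unfolding martingale_difference_def
  proof (intro conjI allI)
    show "adapted T (\<lambda>\<rho> v. partial_sum c m T \<rho> * c T \<rho> v)"
      unfolding adapted_def
    proof (intro allI impI ext)
      fix \<rho> \<rho>' :: "nat \<Rightarrow> 'b" and v assume eq: "\<forall>u\<in>{1..T}. \<rho> u = \<rho>' u"
      have "partial_sum c m T \<rho> = partial_sum c m T \<rho>'"
        by (rule adaptedD[OF partial_sum_adapted[OF c]]) (use eq in blast)
      moreover have "c T \<rho> = c T \<rho>'"
        using c[of T] eq unfolding martingale_difference_def adapted_def by blast
      ultimately show "partial_sum c m T \<rho> * c T \<rho> v = partial_sum c m T \<rho>' * c T \<rho>' v" by simp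
    qed
    show "(\<Sum>v\<in>V. g v * (partial_sum c m T \<rho> * c T \<rho> v)) = 0" for \<rho>
    proof -
      have "(\<Sum>v\<in>V. g v * (partial_sum c m T \<rho> * c T \<rho> v)) = partial_sum c m T \<rho> * (\<Sum>v\<in>V. g v * c T \<rho> v)"
        by (simp add: sum_distrib_left mult.left_commute)
      then show ?thesis using c[of T] by (simp add: martingale_difference_def)
    qed
    show "\<bar>partial_sum c m T \<rho> * c T \<rho> v\<bar> \<le> BA * b T" for \<rho> v
      unfolding abs_mult using partial_sum_bound[OF c, of m T \<rho>] c[of T] BA0
      by (intro mult_mono) (auto simp: BA_def martingale_difference_def)
  qed
  have cross: "expectation (\<lambda>\<omega>. A \<omega> * D \<omega>) = 0"
    using expectation_martingale_difference[OF md] by (simp add: A_def D_def)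
  have "expectation (\<lambda>\<omega>. (partial_sum c m (Suc T) (path \<omega>))\<^sup>2)
      = expectation (\<lambda>\<omega>. (A \<omega>)\<^sup>2 + 2 * (A \<omega> * D \<omega>) + (D \<omega>)\<^sup>2)"
    using step by (simp add: partial_sum_def A_def D_def power2_sum algebra_simps)
  also have "\<dots> = expectation (\<lambda>\<omega>. (A \<omega>)\<^sup>2) + expectation (\<lambda>\<omega>. (D \<omega>)\<^sup>2)"
    using iA iD iAD cross by simp
  also have "expectation (\<lambda>\<omega>. (D \<omega>)\<^sup>2) \<le> expectation (\<lambda>\<omega>. (b T)\<^sup>2)"
    using iD Db b0 by (intro integral_mono) (auto simp: abs_le_square_iff[symmetric])
  finally show ?case using step by (simp add: A_def prob_space)
qed

text \<open>
  Kolmogorov's inequality.  Weights that are switched off once the partial sums have reached \<open>\<epsilon>\<close>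
  are again martingale differences, and their final sum keeps the value at the first passage.
\<close>

lemma maximal_inequality:
  assumes c: "\<And>t. martingale_difference t (c t) (b t)" and "\<epsilon> > 0" "m \<le> N"
  shows "prob {\<omega> \<in> space M. \<exists>T\<in>{m..N}. \<epsilon> \<le> \<bar>partial_sum c m T (path \<omega>)\<bar>} \<le> (\<Sum>t=m..<N. (b t)\<^sup>2) / \<epsilon>\<^sup>2"
proof -
  define c' where "c' t \<rho> v = (if \<forall>u\<in>{m..t}. \<bar>partial_sum c m u \<rho>\<bar> < \<epsilon> then c t \<rho> v else 0)" for t \<rho> v
  have b0: "0 \<le> b t" for t using c[of t] abs_ge_zero order_trans unfolding martingale_difference_def by blast
  have c': "martingale_difference t (c' t) (b t)" for t
    unfolding martingale_difference_def
  proof (intro conjI allI)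
    \<comment> \<open>Partial sums up to index \<open>t\<close> use values up to time
      \<open>t\<close> only, whereas the increment with index \<open>t\<close> uses the value at
      \<open>Suc t\<close>; so the switch is decided before the increment.\<close>
    have P: "partial_sum c m u \<rho> = partial_sum c m u \<rho>'" if "\<forall>u\<in>{1..t}. \<rho> u = \<rho>' u" "u \<le> t" for \<rho> \<rho>' u
      using adaptedD[OF adapted_mono[OF partial_sum_adapted[OF c] that(2)]] that(1) by blast
    show "adapted t (c' t)"
      unfolding adapted_def
    proof (intro allI impI)
      fix \<rho> \<rho>' :: "nat \<Rightarrow> 'b" assume eq: "\<forall>u\<in>{1..t}. \<rho> u = \<rho>' u"
      have "c t \<rho> = c t \<rho>'" using c[of t] eq unfolding martingale_difference_def adapted_def by blast
      then show "c' t \<rho> = c' t \<rho>'" using P[OF eq] by (auto simp: c'_def fun_eq_iff)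
    qed
    show "(\<Sum>v\<in>V. g v * c' t \<rho> v) = 0" for \<rho>
    proof -
      have "c' t \<rho> = c t \<rho> \<or> c' t \<rho> = (\<lambda>_. 0)" by (auto simp: c'_def fun_eq_iff)
      then show ?thesis using c[of t] by (auto simp: martingale_difference_def)
    qed
    show "\<bar>c' t \<rho> v\<bar> \<le> b t" for \<rho> v using c[of t] b0[of t] by (simp add: c'_def martingale_difference_def)
  qed
  have passage: "\<epsilon> \<le> \<bar>partial_sum c' m N \<rho>\<bar>" if ex: "\<exists>T\<in>{m..N}. \<epsilon> \<le> \<bar>partial_sum c m T \<rho>\<bar>" for \<rho>
  proof -
    define T where "T = (LEAST T. T \<in> {m..N} \<and> \<epsilon> \<le> \<bar>partial_sum c m T \<rho>\<bar>)"
    have "T \<in> {m..N} \<and> \<epsilon> \<le> \<bar>partial_sum c m T \<rho>\<bar>"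
      unfolding T_def by (rule LeastI_ex) (use ex in blast)
    then have T: "T \<in> {m..N}" "\<epsilon> \<le> \<bar>partial_sum c m T \<rho>\<bar>" by blast+
    have less: "\<bar>partial_sum c m u \<rho>\<bar> < \<epsilon>" if "u \<in> {m..<T}" for u
      using not_less_Least[of u "\<lambda>T. T \<in> {m..N} \<and> \<epsilon> \<le> \<bar>partial_sum c m T \<rho>\<bar>"] that T(1) unfolding T_def[symmetric] by force
    have "partial_sum c' m N \<rho> = (\<Sum>t=m..<T. c' t \<rho> (\<rho> (Suc t))) + (\<Sum>t=T..<N. c' t \<rho> (\<rho> (Suc t)))"
      unfolding partial_sum_def using T(1) by (intro sum.atLeastLessThan_concat[symmetric]) auto
    also have "(\<Sum>t=T..<N. c' t \<rho> (\<rho> (Suc t))) = 0"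
      using T by (intro sum.neutral) (force simp: c'_def)
    also have "(\<Sum>t=m..<T. c' t \<rho> (\<rho> (Suc t))) = partial_sum c m T \<rho>"
      unfolding partial_sum_def using less by (intro sum.cong refl) (auto simp: c'_def)
    finally show ?thesis using T(2) by simp
  qed
  define Z where "Z \<omega> = partial_sum c' m N (path \<omega>)" for \<omega>
  have Zm [measurable]: "Z \<in> borel_measurable M"
    unfolding Z_def[abs_def] by (rule adapted_measurable[OF partial_sum_adapted[OF c']])
  have Zb: "\<bar>Z \<omega>\<bar> \<le> (\<Sum>t=m..<N. b t)" for \<omega> unfolding Z_def by (rule partial_sum_bound[OF c'])
  have iZ: "integrable M (\<lambda>\<omega>. (Z \<omega>)\<^sup>2)"
    using Zb b0 by (intro integrable_const_bound[of _ "(\<Sum>t=m..<N. b t)\<^sup>2"])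
      (auto simp: abs_le_square_iff[symmetric] sum_nonneg)
  have "prob {\<omega> \<in> space M. \<exists>T\<in>{m..N}. \<epsilon> \<le> \<bar>partial_sum c m T (path \<omega>)\<bar>} \<le> prob {\<omega> \<in> space M. \<epsilon>\<^sup>2 \<le> (Z \<omega>)\<^sup>2}"
    using passage \<open>\<epsilon> > 0\<close> by (intro finite_measure_mono) (force simp: Z_def abs_le_square_iff[symmetric], measurable)
  also have "\<dots> \<le> expectation (\<lambda>\<omega>. (Z \<omega>)\<^sup>2) / \<epsilon>\<^sup>2"
    using iZ \<open>\<epsilon> > 0\<close> by (intro integral_Markov_inequality_measure[of _ _ "{}"]) auto
  also have "\<dots> \<le> (\<Sum>t=m..<N. (b t)\<^sup>2) / \<epsilon>\<^sup>2"
    unfolding Z_def by (intro divide_right_mono second_moment_partial_sum[OF c' \<open>m \<le> N\<close>]) simp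
  finally show ?thesis .
qed

text \<open>The maximal inequality bounds the chance of ever reaching \<open>\<epsilon>\<close> from
  a start at \<open>m\<close> by a tail of the summable series. So almost surely some start stays
  below \<open>\<epsilon>\<close>, and the countably many
  \<open>\<epsilon> = 1 / real (Suc k)\<close> give the Cauchy property.\<close>

theorem AE_convergent_martingale_difference_sum:
  assumes c: "\<And>t. martingale_difference t (c t) (b t)" and b: "summable (\<lambda>t. (b t)\<^sup>2)"
  shows "AE \<omega> in M. convergent (\<lambda>T. partial_sum c 0 T (path \<omega>))"
proof -
  have P [measurable]: "(\<lambda>\<omega>. partial_sum c m T (path \<omega>)) \<in> borel_measurable M" for m T
    by (rule adapted_measurable[OF partial_sum_adapted[OF c]])
  have AE_small: "AE \<omega> in M. \<exists>m. \<forall>T\<ge>m. \<bar>partial_sum c m T (path \<omega>)\<bar> < \<epsilon>" if "\<epsilon> > 0" for \<epsilon> :: real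
  proof -
    define A where "A m N = {\<omega> \<in> space M. \<exists>T\<in>{m..N}. \<epsilon> \<le> \<bar>partial_sum c m T (path \<omega>)\<bar>}" for m N
    define B where "B m = (\<Union>N. A m N)" for m
    have [measurable]: "A m N \<in> events" for m N unfolding A_def by measurable
    have [measurable]: "B m \<in> events" for m unfolding B_def by measurable
    have prob_B: "prob (B m) \<le> (\<Sum>t. (b (t + m))\<^sup>2) / \<epsilon>\<^sup>2" for m
    proof (rule LIMSEQ_le_const2)
      show "(\<lambda>N. prob (A m N)) \<longlonglongrightarrow> prob (B m)"
        unfolding B_def by (intro finite_Lim_measure_incseq) (auto simp: incseq_def A_def intro: order_trans)
      have "prob (A m N) \<le> (\<Sum>t. (b (t + m))\<^sup>2) / \<epsilon>\<^sup>2" if "N \<ge> m" for N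
      proof -
        have "prob (A m N) \<le> (\<Sum>t=m..<N. (b t)\<^sup>2) / \<epsilon>\<^sup>2"
          unfolding A_def by (rule maximal_inequality[OF c \<open>\<epsilon> > 0\<close> that])
        also have "(\<Sum>t=m..<N. (b t)\<^sup>2) = (\<Sum>t<N - m. (b (t + m))\<^sup>2)"
          using sum.shift_bounds_nat_ivl[of "\<lambda>t. (b t)\<^sup>2" 0 m "N - m"] that by (simp add: atLeast0LessThan)
        also have "\<dots> \<le> (\<Sum>t. (b (t + m))\<^sup>2)"
          using b by (intro sum_le_suminf) (auto simp: summable_iff_shift[of "\<lambda>t. (b t)\<^sup>2"])
        finally show ?thesis by (simp add: divide_right_mono)
      qed
      then show "\<exists>N. \<forall>n\<ge>N. prob (A m n) \<le> (\<Sum>t. (b (t + m))\<^sup>2) / \<epsilon>\<^sup>2" by blast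
    qed
    have "(\<lambda>m. (\<Sum>t. (b (t + m))\<^sup>2) / \<epsilon>\<^sup>2) \<longlonglongrightarrow> 0 / \<epsilon>\<^sup>2"
      using suminf_exist_split2[OF b] by (intro tendsto_divide tendsto_const) (use that in auto)
    then have "(\<lambda>m. (\<Sum>t. (b (t + m))\<^sup>2) / \<epsilon>\<^sup>2) \<longlonglongrightarrow> 0" by simp
    \<comment> \<open>The event that every start fails lies in each \<open>B m\<close>, so its
      probability is below all tails.\<close>
    moreover have "prob (\<Inter>m. B m) \<le> (\<Sum>t. (b (t + m))\<^sup>2) / \<epsilon>\<^sup>2" for m
      by (rule order_trans[OF finite_measure_mono prob_B[of m]]) auto
    ultimately have "prob (\<Inter>m. B m) \<le> 0" by (intro LIMSEQ_le_const) auto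
    then have "prob (\<Inter>m. B m) = 0" using measure_nonneg[of M "\<Inter>m. B m"] by (rule antisym)
    then have "AE \<omega> in M. \<omega> \<notin> (\<Inter>m. B m)" by (intro AE_not_in) (simp add: null_sets_def emeasure_eq_measure)
    then show ?thesis
      using AE_space by eventually_elim (force simp: B_def A_def not_le)
  qed
  have "AE \<omega> in M. \<forall>k. \<exists>m. \<forall>T\<ge>m. \<bar>partial_sum c m T (path \<omega>)\<bar> < 1 / real (Suc k)"
    unfolding AE_all_countable by (intro allI AE_small) simp
  then show ?thesis
  proof eventually_elim
    case (elim \<omega>)
    have "Cauchy (\<lambda>T. partial_sum c 0 T (path \<omega>))"
    proof (rule CauchyI')
      fix e :: real assume "e > 0"
      then obtain k where k: "1 / real (Suc k) < e / 2" using nat_approx_posE[of "e / 2"] by auto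
      obtain m where m: "\<forall>T\<ge>m. \<bar>partial_sum c m T (path \<omega>)\<bar> < 1 / real (Suc k)" using elim by blast
      have split: "partial_sum c 0 T (path \<omega>) = partial_sum c 0 m (path \<omega>) + partial_sum c m T (path \<omega>)" if "T \<ge> m" for T
        unfolding partial_sum_def using that by (simp add: sum.atLeastLessThan_concat)
      show "\<exists>M. \<forall>i\<ge>M. \<forall>n>i. dist (partial_sum c 0 i (path \<omega>)) (partial_sum c 0 n (path \<omega>)) < e"
      proof (intro exI[of _ m] allI impI)
        fix i n assume "m \<le> i" "i < n"
        then have "\<bar>partial_sum c m i (path \<omega>)\<bar> < e / 2" "\<bar>partial_sum c m n (path \<omega>)\<bar> < e / 2"
          using m[rule_format, of i] m[rule_format, of n] k by linarith+
        then show "dist (partial_sum c 0 i (path \<omega>)) (partial_sum c 0 n (path \<omega>)) < e"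
          using split[of i] split[of n] \<open>m \<le> i\<close> \<open>i < n\<close> unfolding abs_less_iff dist_real_def by linarith
      qed
    qed
    then show ?case by (simp add: Cauchy_convergent_iff)
  qed
qed

end


section \<open>The channel model and the almost sure statement\<close>

lemma estimator_cong:
  "(\<And>u. u \<in> {1..t} \<Longrightarrow> \<rho> u = \<rho>' u) \<Longrightarrow> estimator K \<eta> P\<^sub>0 P_init \<rho> t = estimator K \<eta> P\<^sub>0 P_init \<rho>' t"
proof (induction t)
  case (Suc t)
  then have "estimator K \<eta> P\<^sub>0 P_init \<rho> t = estimator K \<eta> P\<^sub>0 P_init \<rho>' t" "\<rho> (Suc t) = \<rho>' (Suc t)" by auto
  then show ?case by simp
qed simp

context bsc_model
begin

lemma output_law:
  assumes t: "t \<ge> 1" and r: "r \<in> sign_vectors"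
  shows "prob {\<omega> \<in> space M. R t \<omega> = r} = g_law \<pi> r"
proof -
  have "(\<lambda>\<omega>. (S t \<omega>, R t \<omega>)) \<in> measurable M (count_space UNIV)"
    using indep_over_time t by (simp add: indep_vars_def)
  from measurable_sets[OF this, of "{p. P (fst p) (snd p)}" for P]
  have ev [simp]: "{\<omega> \<in> space M. P (S t \<omega>) (R t \<omega>)} \<in> events" for P
    by (simp add: vimage_def Int_def conj_commute)
  \<comment> \<open>Under the input 1 an entry 1 is an unflipped one and has probability
    \<open>1 - \<pi> $ i\<close>, while \<open>chan\<close> assigns \<open>\<pi> $ i\<close> to it;
    hence \<open>- r\<close>.\<close>
  have joint: "prob {\<omega> \<in> space M. R t \<omega> = r \<and> S t \<omega> = s} = wt (if s = 1 then - r else r) \<pi> / 2"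
    if s: "s \<in> {-1, 1}" for s
  proof -
    have "\<P>(\<omega> in M. R t \<omega> $ i = r $ i \<bar> S t \<omega> = s) = chan ((if s = 1 then - r else r) $ i) (\<pi> $ i)" for i
      using channel_flip[OF t s, of i] channel_keep[OF t s, of i] sign_vectors_cases[OF r, of i] s
      by (auto simp: chan_def)
    then have "\<P>(\<omega> in M. R t \<omega> = r \<bar> S t \<omega> = s) = wt (if s = 1 then - r else r) \<pi>"
      using outputs_cond_indep[OF t s r] by (simp add: wt_def)
    then show ?thesis using input_uniform[OF t s] by (simp add: cond_prob_def)
  qed
  \<comment> \<open>Two masses of 1/2 exhaust the probability, so the input is almost surely a sign
    and the law of the output splits over the two inputs.\<close>
  have "prob {\<omega> \<in> space M. S t \<omega> = 1 \<or> S t \<omega> = - 1}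
      = prob ({\<omega> \<in> space M. S t \<omega> = 1} \<union> {\<omega> \<in> space M. S t \<omega> = - 1})"
    by (rule arg_cong[where f = prob]) auto
  also have "\<dots> = prob {\<omega> \<in> space M. S t \<omega> = 1} + prob {\<omega> \<in> space M. S t \<omega> = - 1}"
    using ev[of "\<lambda>s _. s = 1"] ev[of "\<lambda>s _. s = - 1"] by (intro finite_measure_Union) auto
  also have "\<dots> = 1" using input_uniform[OF t, of 1] input_uniform[OF t, of "- 1"] by simp
  finally have "AE \<omega> in M. S t \<omega> = 1 \<or> S t \<omega> = - 1"
    using prob_eq_1[OF ev[of "\<lambda>s _. s = 1 \<or> s = - 1"]] by simp
  then have "prob {\<omega> \<in> space M. R t \<omega> = r}
      = prob ({\<omega> \<in> space M. R t \<omega> = r \<and> S t \<omega> = 1} \<union> {\<omega> \<in> space M. R t \<omega> = r \<and> S t \<omega> = - 1})"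
    using ev[of "\<lambda>_ x. x = r"] ev[of "\<lambda>s x. x = r \<and> s = 1"] ev[of "\<lambda>s x. x = r \<and> s = - 1"]
    by (intro finite_measure_eq_AE) auto
  also have "\<dots> = prob {\<omega> \<in> space M. R t \<omega> = r \<and> S t \<omega> = 1} + prob {\<omega> \<in> space M. R t \<omega> = r \<and> S t \<omega> = - 1}"
    using ev[of "\<lambda>s x. x = r \<and> s = 1"] ev[of "\<lambda>s x. x = r \<and> s = - 1"] by (intro finite_measure_Union) auto
  also have "\<dots> = g_law \<pi> r"
    using joint[of 1] joint[of "- 1"] by (simp add: g_law_eq_mix[OF r] mix_def add.commute)
  finally show ?thesis .
qed

sublocale outputs: iid_sequence M R sign_vectors "g_law \<pi>"
proof
  show "indep_vars (\<lambda>_. count_space UNIV) R {1..}"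
    using indep_vars_compose2[OF indep_over_time, of "\<lambda>_. snd" "\<lambda>_. count_space UNIV"] by simp
qed (auto simp: output_law sum_g_law)

end

theorem theorem2:
  fixes M :: "'a measure"
    and \<pi> :: "real ^ 'n::finite"
    and S :: "nat \<Rightarrow> 'a \<Rightarrow> int"
    and R :: "nat \<Rightarrow> 'a \<Rightarrow> int ^ 'n"
    and \<eta> :: "nat \<Rightarrow> real"
    and K :: "nat \<Rightarrow> (real ^ 'n) set"
    and P\<^sub>0 P_init :: "real ^ 'n"
  assumes "CARD('n) \<ge> 2"
    and "\<And>i. 0 < \<pi> $ i \<and> \<pi> $ i < 1"
    and "bsc_model M \<pi> S R"
    and "\<And>t. \<eta> t > 0"
    and "decseq \<eta>"
    and "\<not> summable \<eta>"
    and "summable (\<lambda>t. (\<eta> t)\<^sup>2)"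
    and "truncation_sets K"
    and "exhausts_compacts K"
    and "P\<^sub>0 \<in> K 0"
    and "P_init \<in> K 0"
  shows "AE \<omega> in M. (\<lambda>t. infdist (P_pr K \<eta> P\<^sub>0 P_init (\<lambda>t. R t \<omega>) t) (E_bar \<pi>)) \<longlonglongrightarrow> 0"
proof -
  interpret bsc_model M \<pi> S R by fact
  let ?X = "P_pr K \<eta> P\<^sub>0 P_init"
  \<comment> \<open>The level set makes the increments bounded uniformly over histories, and the
    test on \<open>v\<close> extends the bound to values that are not sign vectors.\<close>
  define c where "c k t \<rho> v = (if ?X \<rho> t \<in> level_set (1 / real (Suc k)) \<and> v \<in> sign_vectors
      then \<eta> t * noise \<pi> v (?X \<rho> t) else 0)" for k t \<rho> v
  define B where "B k = 2 * CARD('n) / (1 / real (Suc k))\<^sup>2" for k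
  have md: "outputs.martingale_difference t (c k t) (\<eta> t * B k)" for k t
    unfolding outputs.martingale_difference_def
  proof (intro conjI allI)
    show "adapted t (c k t)"
      unfolding adapted_def
    proof (intro allI impI)
      fix \<rho> \<rho>' :: "nat \<Rightarrow> int ^ 'n" assume "\<forall>u\<in>{1..t}. \<rho> u = \<rho>' u"
      then have "?X \<rho> t = ?X \<rho>' t"
        unfolding P_pr_def by (subst estimator_cong[of t \<rho> \<rho>']) auto
      then show "c k t \<rho> = c k t \<rho>'" unfolding c_def by (simp only:)
    qed
    show "(\<Sum>v\<in>sign_vectors. g_law \<pi> v * c k t \<rho> v) = 0" for \<rho>
    proof (cases "?X \<rho> t \<in> level_set (1 / real (Suc k))")
      case True
      then have "(\<Sum>v\<in>sign_vectors. g_law \<pi> v * c k t \<rho> v)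
          = \<eta> t * (\<Sum>v\<in>sign_vectors. g_law \<pi> v * noise \<pi> v (?X \<rho> t))"
        unfolding sum_distrib_left by (intro sum.cong) (auto simp: c_def)
      then show ?thesis by (simp add: noise_mean_zero)
    qed (simp add: c_def)
    show "\<bar>c k t \<rho> v\<bar> \<le> \<eta> t * B k" for \<rho> v
    proof (cases "?X \<rho> t \<in> level_set (1 / real (Suc k)) \<and> v \<in> sign_vectors")
      case True
      then have "\<bar>noise \<pi> v (?X \<rho> t)\<bar> \<le> B k"
        unfolding B_def by (intro noise_bound assms(2)) auto
      then show ?thesis using True assms(4)[of t] by (simp add: c_def abs_mult)
    next
      case False
      then have "c k t \<rho> v = 0" by (auto simp: c_def)
      then show ?thesis using assms(4)[of t] by (simp add: B_def)
    qed
  qed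
  have sq: "summable (\<lambda>t. (\<eta> t * B k)\<^sup>2)" for k
    using summable_mult2[OF assms(7), of "(B k)\<^sup>2"] by (simp add: power_mult_distrib)
  have "AE \<omega> in M. \<forall>k. convergent (\<lambda>T. outputs.partial_sum (c k) 0 T (\<lambda>t. R t \<omega>))"
    unfolding AE_all_countable by (intro allI outputs.AE_convergent_martingale_difference_sum[OF md sq])
  moreover have "AE \<omega> in M. \<forall>t. R (Suc t) \<omega> \<in> sign_vectors"
    unfolding AE_all_countable by (intro allI outputs.AE_Y_in_V) simp
  ultimately show ?thesis
  proof eventually_elim
    case (elim \<omega>)
    \<comment> \<open>On this path all observations are sign vectors, so the test on
      \<open>v\<close> disappears and the sums are those of \<open>noise_convergent\<close>.\<close>
    let ?r = "\<lambda>t. R t \<omega>"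
    have eq: "outputs.partial_sum (c k) 0 T ?r = (\<Sum>t<T. if ?X ?r t \<in> level_set (1 / real (Suc k))
        then \<eta> t * noise \<pi> (?r (Suc t)) (?X ?r t) else 0)" for k T
      unfolding outputs.partial_sum_def atLeast0LessThan using elim(2) by (intro sum.cong) (auto simp: c_def)
    have conv: "convergent (\<lambda>T. \<Sum>t<T. if ?X ?r t \<in> level_set (1 / real (Suc k))
        then \<eta> t * noise \<pi> (?r (Suc t)) (?X ?r t) else 0)" for k
      unfolding eq[symmetric] using elim(1) by (rule spec)
    have signs: "?r t \<in> sign_vectors" if "t \<ge> 1" for t
      using elim(2)[rule_format, of "t - 1"] that by simp
    interpret resetting_run \<pi> \<eta> K P\<^sub>0 P_init ?r
      by (rule resetting_run.intro[OF assms(2,4,6-11) signs conv])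
    show ?case using run_converges unfolding X_def P_pr_def .
  qed
qed

end
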